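(* Let $(\alpha_k)_{k\in\mathbb N}$ be a sequence of positive real numbers such that $\sum_{k=0}^\infty\alpha_k<1$ and $\sum_{k=0}^\infty k\alpha_k<+\infty$. Let $(X_k)_{k\ge1}$ and $H_n=\sum_{k=1}^nX_k$ be the associated discrete Hawkes process, and set $|\alpha|:=\sum_{k\ge1}\alpha_k$, $\varsigma^2:=\frac{\alpha_0}{1-|\alpha|}$. Then there exists $C>0$ such that for all integers $n\ge1$, $$d_W\Big(\frac{H_n-n\varsigma^2}{\sqrt n},\overline G\Big)\le\frac{C}{\sqrt n},\qquad\overline G\sim\mathcal N\Big(0,\frac{\varsigma^2}{(1-|\alpha|)^2}\Big).$$
   Context: Discrete Hawkes process: with $\mathcal P(\beta)$ the Poisson law of mean $\beta>0$, $X_1\sim\mathcal P(\alpha_0)$ and, for each $k\ge1$, conditionally on $\sigma(X_i,\,i\le k-1)$, $X_k\sim\mathcal P\big(\alpha_0+\sum_{i=1}^{k-1}\alpha_{k-i}X_i\big)$. Wasserstein distance: $d_W(F,G)=\sup_u|\mathbb E[u(F)]-\mathbb E[u(G)]|$ over $1$-Lipschitz $u:\mathbb R\to\mathbb R$. *)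

theory Defs
  imports "HOL-Probability.Probability"
begin

(* \<sigma>(X_i, 1 \<le> i \<le> k - 1); trivial for k = 1. *)
definition hawkes_past :: "'a measure \<Rightarrow> (nat \<Rightarrow> 'a \<Rightarrow> nat) \<Rightarrow> nat \<Rightarrow> 'a measure" where
  "hawkes_past M X k =
     sigma (space M) (\<Union>i\<in>{1..<k}. {X i -` A \<inter> space M | A. A \<subseteq> UNIV})"

(* P(Y \<in> A | F) = K(A) almost surely for every A.  For a sub-\<sigma>-algebra F of a probability
   space M this is the usual conditional law; real_cond_exp is only meaningful in that case. *)
definition has_cond_law ::
    "'a measure \<Rightarrow> 'a measure \<Rightarrow> ('a \<Rightarrow> nat) \<Rightarrow> ('a \<Rightarrow> nat pmf) \<Rightarrow> bool" where
  "has_cond_law M F Y K \<longleftrightarrow>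
     (\<forall>A. AE \<omega> in M. real_cond_exp M F (indicator (Y -` A \<inter> space M)) \<omega>
                      = measure_pmf.prob (K \<omega>) A)"

definition hawkes_intensity :: "(nat \<Rightarrow> real) \<Rightarrow> (nat \<Rightarrow> 'a \<Rightarrow> nat) \<Rightarrow> nat \<Rightarrow> 'a \<Rightarrow> real" where
  "hawkes_intensity \<alpha> X k \<omega> = \<alpha> 0 + (\<Sum>i\<in>{1..<k}. \<alpha> (k - i) * real (X i \<omega>))"

(* The process is indexed by k \<ge> 1, so X 0 is unconstrained and never used.  For k = 1 the
   condition says that X 1 is Poisson with mean \<alpha> 0. *)
locale discrete_hawkes = prob_space M
  for M :: "'a measure" and \<alpha> :: "nat \<Rightarrow> real" and X :: "nat \<Rightarrow> 'a \<Rightarrow> nat" +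
  assumes measurable_X: "k \<ge> 1 \<Longrightarrow> X k \<in> measurable M (count_space UNIV)"
    and cond_law_X: "k \<ge> 1 \<Longrightarrow>
      has_cond_law M (hawkes_past M X k) (X k) (\<lambda>\<omega>. poisson_pmf (hawkes_intensity \<alpha> X k \<omega>))"

definition hawkes_count :: "(nat \<Rightarrow> 'a \<Rightarrow> nat) \<Rightarrow> nat \<Rightarrow> 'a \<Rightarrow> nat" where
  "hawkes_count X n \<omega> = (\<Sum>k = 1..n. X k \<omega>)"

(* Distance between laws on the real line: d_W(F, G) is the value at the laws of F and G.  The
   supremum is in ennreal, so an unbounded family gives \<infinity>.  The convention that a
   non-integrable function has integral 0 is harmless: if one law has a finite first moment and
   the other has not, the bounded functions u = min |x| m already make the supremum \<infinity>. *)
definition wasserstein_dist :: "real measure \<Rightarrow> real measure \<Rightarrow> ennreal" where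
  "wasserstein_dist \<mu> \<nu> =
     (SUP u\<in>{u :: real \<Rightarrow> real. 1-lipschitz_on UNIV u}.
        ennreal \<bar>(\<integral>x. u x \<partial>\<mu>) - (\<integral>x. u x \<partial>\<nu>)\<bar>)"

(* normal_density takes the standard deviation, not the variance. *)
definition normal_law :: "real \<Rightarrow> real \<Rightarrow> real measure" where
  "normal_law m v = density lborel (\<lambda>x. ennreal (normal_density m (sqrt v) x))"

end

theory Submission
  imports Defs "HOL-Real_Asymp.Real_Asymp"
begin

text \<open>
  Write \<open>\<mu>\<close> for the sum of the \<open>\<alpha> k\<close> with \<open>k \<ge> 1\<close>. If immigration stops after time \<open>n\<close>, the events up to
  time \<open>n\<close> together with all their later descendants form the total progeny of a
  Poisson(\<open>n * \<alpha> 0\<close>) number of independent Galton-Watson trees with Poisson(\<open>\<mu>\<close>) offspring,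
  whose law is explicit (generalized Poisson). Given the first \<open>n\<close> steps, the number of
  descendants still to be born is again generalized Poisson, and its mean is bounded uniformly
  in \<open>n\<close> because the \<open>k * \<alpha> k\<close> are summable. So \<open>H_n\<close> is within bounded \<open>L\<^sup>1\<close> distance of a generalized
  Poisson variable \<open>D\<close> with parameter \<open>\<theta> = n * \<alpha> 0\<close>. An elementary identity between the weights of
  parameters \<open>\<theta>\<close> and \<open>\<theta> + \<mu>\<close> expresses \<open>E[D h(D)]\<close> by \<open>D + B\<close> with \<open>B\<close> independent of \<open>D\<close>, and
  Stein's method then gives the normal approximation of \<open>D\<close> at rate \<open>1 / sqrt n\<close>.
\<close>

section \<open>Generalized Poisson distributions\<close>

text \<open>The kernel spreads the offspring of an event over all later times. Waiting until every
  descendant is born erases the dates: only the total mean \<open>\<mu>\<close> then matters, which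
  is why a closed form appears. No tree is ever constructed. The conditional laws determine the law
  of the finite history, a \<open>pmf\<close> on lists, and the unborn descendants are drawn
  afterwards with a parameter that depends on the history only through \<open>pending\<close>. One
  Hawkes step is then one instance of an Abel-type convolution identity. A bounded error in the
  count is affordable because a test function of \<open>H_n / sqrt n\<close> has Lipschitz constant
  \<open>1 / sqrt n\<close> in \<open>H_n\<close>. In Stein's method the size bias of
  \<open>D\<close> carries the random factor \<open>\<theta> + \<mu> * (D + B)\<close>, where
  \<open>B\<close> is the size of a single tree; for a Poisson variable this factor is constant.
  Moving its \<open>D\<close>-dependent main part to the left leaves
  \<open>(1 - \<mu>) * (D - m)\<close> with \<open>m = \<theta> / (1 - \<mu>)\<close>. The other
  terms stay bounded for test functions living on the scale of the standard deviation.\<close>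

text \<open>These are the Abel polynomials in \<open>a\<close>. The case \<open>k = 0\<close> is
  separate because \<open>k - 1\<close> truncates to 0 there and the formula would give
  \<open>a\<close> instead of 1.\<close>

definition abel_poly :: "real \<Rightarrow> nat \<Rightarrow> real \<Rightarrow> real" where
  "abel_poly \<mu> k a = (if k = 0 then 1 else a * (a + \<mu> * real k) ^ (k - 1))"

lemma abel_poly_0 [simp]: "abel_poly \<mu> 0 a = 1"
  by (simp add: abel_poly_def)

lemma abel_poly_at_0: "abel_poly \<mu> k 0 = (if k = 0 then 1 else 0)"
  by (simp add: abel_poly_def)

lemma abel_poly_nonneg: "0 \<le> \<mu> \<Longrightarrow> 0 \<le> a \<Longrightarrow> 0 \<le> abel_poly \<mu> k a"
  by (simp add: abel_poly_def)

text \<open>The two terms of the product rule share a power of \<open>a + \<mu> * (k + 1)\<close>,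
  and the remaining factors add up to \<open>(k + 1) * (a + \<mu>)\<close>. Lowering the index while
  shifting the argument is what drives the induction in \<open>abel_binomial\<close>.\<close>

lemma has_derivative_abel_poly:
  "(abel_poly \<mu> (Suc k) has_real_derivative real (Suc k) * abel_poly \<mu> k (a + \<mu>)) (at a)"
proof -
  have "((\<lambda>a. a * (a + \<mu> * real (Suc k)) ^ k) has_real_derivative
      (a + \<mu> * real (Suc k)) ^ k + a * (real k * (a + \<mu> * real (Suc k)) ^ (k - 1))) (at a)"
    by (auto intro!: derivative_eq_intros)
  also have "(a + \<mu> * real (Suc k)) ^ k + a * (real k * (a + \<mu> * real (Suc k)) ^ (k - 1))
      = real (Suc k) * abel_poly \<mu> k (a + \<mu>)"
  proof (cases k)
    case (Suc l)
    have "a + \<mu> + \<mu> * real k = a + \<mu> * real (Suc k)"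
      by (simp add: algebra_simps)
    then show ?thesis
      unfolding abel_poly_def using Suc by (simp add: algebra_simps)
  qed simp
  finally show ?thesis
    by (simp add: abel_poly_def[abs_def])
qed

text \<open>For \<open>\<delta> = \<mu>\<close> this is Abel's identity; for \<open>\<delta> = 0\<close> the first factor is \<open>a ^ x\<close>. Both sides agree at
  \<open>a = 0\<close>, and differentiating in \<open>a\<close> reduces \<open>k + 1\<close> to \<open>k\<close>.\<close>

lemma abel_binomial:
  "(\<Sum>x\<le>k. real (k choose x) * abel_poly \<delta> x a * abel_poly \<mu> (k - x) (b + (\<mu> - \<delta>) * real x))
     = abel_poly \<mu> k (a + b)"
proof (induction k arbitrary: a b)
  case (Suc k)
  define F where "F a = (\<Sum>x\<le>Suc k. real (Suc k choose x) * abel_poly \<delta> x a *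
      abel_poly \<mu> (Suc k - x) (b + (\<mu> - \<delta>) * real x)) - abel_poly \<mu> (Suc k) (a + b)" for a
  have F_Suc: "F a = abel_poly \<mu> (Suc k) b
      + (\<Sum>x\<le>k. real (Suc k choose Suc x) * abel_poly \<delta> (Suc x) a *
          abel_poly \<mu> (k - x) (b + (\<mu> - \<delta>) * real (Suc x))) - abel_poly \<mu> (Suc k) (a + b)" for a
    unfolding F_def by (subst sum.atMost_Suc_shift) simp
  have "(F has_real_derivative 0) (at a)" for a
  proof -
    have "(F has_real_derivative
        (\<Sum>x\<le>k. real (Suc k choose Suc x) * (real (Suc x) * abel_poly \<delta> x (a + \<delta>)) *
          abel_poly \<mu> (k - x) (b + (\<mu> - \<delta>) * real (Suc x)))
        - real (Suc k) * abel_poly \<mu> k (a + b + \<mu>)) (at a)"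
      unfolding F_Suc[abs_def]
      by (auto intro!: derivative_eq_intros has_derivative_abel_poly
            DERIV_chain2[OF has_derivative_abel_poly] sum.cong
          simp: mult_ac simp del: of_nat_Suc binomial_Suc_Suc)
    \<comment> \<open>Absorption pulls out the factor \<open>Suc k\<close>, and the index shift
      moves one \<open>\<mu> - \<delta>\<close> into \<open>b\<close>. The sum becomes the induction
      hypothesis at \<open>a + \<delta>\<close> and \<open>b + (\<mu> - \<delta>)\<close>, whose
      total is \<open>a + b + \<mu>\<close>.\<close>
    also have "(\<Sum>x\<le>k. real (Suc k choose Suc x) * (real (Suc x) * abel_poly \<delta> x (a + \<delta>)) *
          abel_poly \<mu> (k - x) (b + (\<mu> - \<delta>) * real (Suc x)))
        = real (Suc k) * (\<Sum>x\<le>k. real (k choose x) * abel_poly \<delta> x (a + \<delta>) *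
          abel_poly \<mu> (k - x) ((b + (\<mu> - \<delta>)) + (\<mu> - \<delta>) * real x))"
      unfolding sum_distrib_left
    proof (rule sum.cong[OF refl])
      fix x
      have "real (Suc k choose Suc x) * real (Suc x) = real (Suc k) * real (k choose x)"
        by (metis Suc_times_binomial_eq mult.commute of_nat_mult)
      moreover have "b + (\<mu> - \<delta>) * real (Suc x) = (b + (\<mu> - \<delta>)) + (\<mu> - \<delta>) * real x"
        by (simp add: algebra_simps)
      ultimately show "real (Suc k choose Suc x) * (real (Suc x) * abel_poly \<delta> x (a + \<delta>)) *
          abel_poly \<mu> (k - x) (b + (\<mu> - \<delta>) * real (Suc x)) =
        real (Suc k) * (real (k choose x) * abel_poly \<delta> x (a + \<delta>) *
          abel_poly \<mu> (k - x) ((b + (\<mu> - \<delta>)) + (\<mu> - \<delta>) * real x))"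
        by (metis (no_types, lifting) mult.assoc)
    qed
    also have "\<dots> = real (Suc k) * abel_poly \<mu> k (a + b + \<mu>)"
      unfolding Suc.IH by (simp add: algebra_simps)
    finally show ?thesis by simp
  qed
  then have "F a = F 0"
    by (rule DERIV_isconst_all[rule_format, of F])
  also have "F 0 = 0"
    unfolding F_Suc by (simp add: abel_poly_at_0)
  finally show ?case
    by (simp add: F_def)
qed simp

text \<open>The probability that a Poisson(\<open>\<theta>\<close>) number of Galton-Watson trees with Poisson(\<open>\<mu>\<close>) offspring
  have \<open>k\<close> vertices in total; Poisson(\<open>\<theta>\<close>) itself for \<open>\<mu> = 0\<close>.\<close>

definition gen_poisson :: "real \<Rightarrow> real \<Rightarrow> nat \<Rightarrow> real" where
  "gen_poisson \<mu> \<theta> k = abel_poly \<mu> k \<theta> * exp (- (\<theta> + \<mu> * real k)) / fact k"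

lemma gen_poisson_nonneg: "0 \<le> \<mu> \<Longrightarrow> 0 \<le> \<theta> \<Longrightarrow> 0 \<le> gen_poisson \<mu> \<theta> k"
  by (simp add: gen_poisson_def abel_poly_nonneg)

lemma gen_poisson_at_0 [simp]: "gen_poisson \<mu> \<theta> 0 = exp (- \<theta>)"
  by (simp add: gen_poisson_def)

lemma gen_poisson_mean_0: "gen_poisson \<mu> 0 k = (if k = 0 then 1 else 0)"
  by (simp add: gen_poisson_def abel_poly_at_0)

lemma gen_poisson_mu_0: "gen_poisson 0 \<theta> k = \<theta> ^ k / fact k * exp (- \<theta>)"
  by (cases k) (simp_all add: gen_poisson_def abel_poly_def)

text \<open>The exponents add up to \<open>a + b + \<mu> * k\<close> for every \<open>x\<close>,
  which leaves \<open>abel_binomial\<close>. For \<open>\<delta> = \<mu>\<close> it is additivity in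
  the parameter. For \<open>\<delta> = 0\<close> the first factor counts a Poisson generation, each
  member of which adds \<open>\<mu>\<close> to the parameter of what follows.\<close>

lemma gen_poisson_convolution:
  "(\<Sum>x\<le>k. gen_poisson \<delta> a x * gen_poisson \<mu> (b + (\<mu> - \<delta>) * real x) (k - x))
     = gen_poisson \<mu> (a + b) k"
proof -
  have "gen_poisson \<delta> a x * gen_poisson \<mu> (b + (\<mu> - \<delta>) * real x) (k - x)
    = (real (k choose x) * abel_poly \<delta> x a * abel_poly \<mu> (k - x) (b + (\<mu> - \<delta>) * real x))
        * (exp (- (a + b + \<mu> * real k)) / fact k)" if "x \<le> k" for x
  proof -
    have "exp (- (a + b + \<mu> * real k)) = exp (- (a + \<delta> * real x))
        * exp (- (b + (\<mu> - \<delta>) * real x + \<mu> * real (k - x)))"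
      using that by (simp add: exp_add[symmetric] of_nat_diff algebra_simps)
    then show ?thesis
      using that by (simp add: gen_poisson_def binomial_fact field_simps)
  qed
  then have "(\<Sum>x\<le>k. gen_poisson \<delta> a x * gen_poisson \<mu> (b + (\<mu> - \<delta>) * real x) (k - x))
    = (\<Sum>x\<le>k. real (k choose x) * abel_poly \<delta> x a * abel_poly \<mu> (k - x) (b + (\<mu> - \<delta>) * real x))
        * (exp (- (a + b + \<mu> * real k)) / fact k)"
    unfolding sum_distrib_right by (intro sum.cong) auto
  then show ?thesis
    by (simp add: abel_binomial gen_poisson_def)
qed

text \<open>Since \<open>\<theta> + \<mu> + \<mu> * k = \<theta> + \<mu> * (k + 1)\<close>, both
  weights have the same exponential and powers of the same base. For \<open>\<mu> = 0\<close> this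
  is the Poisson relation behind the Stein-Chen method.\<close>

lemma gen_poisson_size_bias:
  assumes "0 \<le> \<mu>" "0 < \<theta>"
  shows "(\<theta> + \<mu>) * (real (Suc k) * gen_poisson \<mu> \<theta> (Suc k))
    = \<theta> * ((\<theta> + \<mu> * real (Suc k)) * gen_poisson \<mu> (\<theta> + \<mu>) k)"
proof -
  have pos: "0 < \<theta> + \<mu> * real (Suc k)"
    using assms by (intro add_pos_nonneg) auto
  have *: "\<theta> + \<mu> + \<mu> * real k = \<theta> + \<mu> * real (Suc k)"
    by (simp add: algebra_simps)
  have "(\<theta> + \<mu> * real (Suc k)) * abel_poly \<mu> k (\<theta> + \<mu>) = (\<theta> + \<mu>) * (\<theta> + \<mu> * real (Suc k)) ^ k"
  proof (cases k)
    case 0 then show ?thesis by simp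
  next
    case (Suc l)
    then show ?thesis unfolding abel_poly_def * by simp
  qed
  then have "\<theta> * ((\<theta> + \<mu> * real (Suc k)) * abel_poly \<mu> k (\<theta> + \<mu>))
      = (\<theta> + \<mu>) * abel_poly \<mu> (Suc k) \<theta>"
    by (simp add: abel_poly_def)
  moreover have "real (Suc k) * (y / fact (Suc k)) = y / fact k" for y :: real
    by (simp add: field_simps del: of_nat_Suc)
  moreover have "(\<theta> + \<mu>) * (real (Suc k) * gen_poisson \<mu> \<theta> (Suc k)) = real (Suc k) *
      ((\<theta> + \<mu>) * abel_poly \<mu> (Suc k) \<theta> * exp (- (\<theta> + \<mu> * real (Suc k))) / fact (Suc k))"
    unfolding gen_poisson_def by (simp del: of_nat_Suc fact_Suc)
  ultimately show ?thesis
    unfolding gen_poisson_def[of \<mu> "\<theta> + \<mu>"] * by simp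
qed

section \<open>Truncated moments and total mass of the weights\<close>

lemma poisson_partial_sums:
  fixes \<theta> :: real
  assumes "0 \<le> \<theta>"
  shows "(\<Sum>x\<le>K. gen_poisson 0 \<theta> x) \<le> 1"
    and "(\<Sum>x\<le>K. gen_poisson 0 \<theta> x * real x) \<le> \<theta>"
    and "(\<Sum>x\<le>K. gen_poisson 0 \<theta> x * real x ^ 2) \<le> \<theta> + \<theta>\<^sup>2"
proof -
  have A: "(\<Sum>x\<le>K. gen_poisson 0 \<theta> x) \<le> 1" for K
  proof -
    have "(\<Sum>x<Suc K. \<theta> ^ x /\<^sub>R fact x) \<le> exp \<theta>"
      unfolding exp_def using assms
      by (intro sum_le_suminf summable_exp_generic) auto
    then have "(\<Sum>x\<le>K. \<theta> ^ x / fact x) * exp (-\<theta>) \<le> exp \<theta> * exp (-\<theta>)"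
      by (intro mult_right_mono) (simp_all add: lessThan_Suc_atMost divide_inverse mult.commute)
    then show ?thesis
      by (simp add: gen_poisson_mu_0 sum_distrib_right exp_add[symmetric])
  qed
  show "(\<Sum>x\<le>K. gen_poisson 0 \<theta> x) \<le> 1" by (rule A)
  have S: "gen_poisson 0 \<theta> (Suc x) * real (Suc x) = \<theta> * gen_poisson 0 \<theta> x" for x
    by (simp add: gen_poisson_mu_0 field_simps del: of_nat_Suc)
  have B: "(\<Sum>x\<le>K. gen_poisson 0 \<theta> x * real x) \<le> \<theta>" for K
  proof (cases K)
    case (Suc L)
    have "(\<Sum>x\<le>K. gen_poisson 0 \<theta> x * real x) = \<theta> * (\<Sum>x\<le>L. gen_poisson 0 \<theta> x)"
      unfolding Suc sum.atMost_Suc_shift S sum_distrib_left by simp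
    also have "\<dots> \<le> \<theta> * 1" using A assms by (intro mult_left_mono) auto
    finally show ?thesis by simp
  qed (use assms in simp)
  show "(\<Sum>x\<le>K. gen_poisson 0 \<theta> x * real x) \<le> \<theta>" by (rule B)
  show "(\<Sum>x\<le>K. gen_poisson 0 \<theta> x * real x ^ 2) \<le> \<theta> + \<theta>\<^sup>2"
  proof (cases K)
    case (Suc L)
    have S2: "gen_poisson 0 \<theta> (Suc x) * real (Suc x) ^ 2
        = \<theta> * gen_poisson 0 \<theta> x + \<theta> * (gen_poisson 0 \<theta> x * real x)" for x
      unfolding power2_eq_square mult.assoc[symmetric] S by (simp add: algebra_simps)
    have "(\<Sum>x\<le>K. gen_poisson 0 \<theta> x * real x ^ 2)
        = \<theta> * (\<Sum>x\<le>L. gen_poisson 0 \<theta> x) + \<theta> * (\<Sum>x\<le>L. gen_poisson 0 \<theta> x * real x)"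
      unfolding Suc sum.atMost_Suc_shift S2 sum_distrib_left by (simp add: sum.distrib)
    also have "\<dots> \<le> \<theta> * 1 + \<theta> * \<theta>" using A B assms by (intro add_mono mult_left_mono) auto
    finally show ?thesis by (simp add: power2_eq_square)
  qed (use assms in simp)
qed

text \<open>Decomposition by the size \<open>x\<close> of the first generation. Truncating the total
  at \<open>K\<close> truncates the later generations at \<open>K - x\<close>, which permits
  induction on \<open>K\<close>.\<close>

lemma gen_poisson_partial_sum:
  "(\<Sum>k\<le>K. g k * gen_poisson \<mu> \<theta> k)
     = (\<Sum>x\<le>K. gen_poisson 0 \<theta> x * (\<Sum>j\<le>K - x. g (x + j) * gen_poisson \<mu> (\<mu> * real x) j))"
proof -
  have "(\<Sum>k\<le>K. g k * gen_poisson \<mu> \<theta> k)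
      = (\<Sum>k\<le>K. \<Sum>x\<le>k. g (x + (k - x)) * (gen_poisson 0 \<theta> x * gen_poisson \<mu> (\<mu> * real x) (k - x)))"
    using gen_poisson_convolution[of 0 \<theta> \<mu> 0] by (simp add: sum_distrib_left[symmetric])
  also have "\<dots> = (\<Sum>(x,j)\<in>{(x,j). x + j \<le> K}.
      g (x + j) * (gen_poisson 0 \<theta> x * gen_poisson \<mu> (\<mu> * real x) j))"
    by (rule sum.triangle_reindex_eq[symmetric])
  also have "{(x,j). x + j \<le> K} = (SIGMA x:{..K}. {..K - x})"
    by auto
  finally show ?thesis
    by (simp add: sum.Sigma[symmetric] sum_distrib_left mult_ac)
qed

text \<open>Summability is not yet available, so the bounds are proved for truncated sums by
  induction on the truncation. A first generation \<open>x > 0\<close> shrinks it to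
  \<open>K - x\<close>; for \<open>x = 0\<close> the inner parameter is 0 and its law sits at 0. The
  bounds reproduce themselves under this recursion because
  \<open>1 + \<mu> / (1 - \<mu>) = 1 / (1 - \<mu>)\<close>.\<close>

lemma gen_poisson_partial_moments:
  assumes "0 \<le> \<mu>" "\<mu> < 1" "0 \<le> \<theta>"
  shows "(\<Sum>k\<le>K. gen_poisson \<mu> \<theta> k) \<le> 1 \<and>
    (\<Sum>k\<le>K. real k * gen_poisson \<mu> \<theta> k) \<le> \<theta> / (1 - \<mu>) \<and>
    (\<Sum>k\<le>K. real k ^ 2 * gen_poisson \<mu> \<theta> k) \<le> \<theta> / (1 - \<mu>) ^ 3 + (\<theta> / (1 - \<mu>))\<^sup>2"
  using assms(3)
proof (induction K arbitrary: \<theta> rule: less_induct)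
  case (less K)
  have IH: "(\<Sum>j\<le>K - x. gen_poisson \<mu> (\<mu> * real x) j) \<le> 1"
    "(\<Sum>j\<le>K - x. real j * gen_poisson \<mu> (\<mu> * real x) j) \<le> \<mu> * real x / (1 - \<mu>)"
    "(\<Sum>j\<le>K - x. real j ^ 2 * gen_poisson \<mu> (\<mu> * real x) j)
       \<le> \<mu> * real x / (1 - \<mu>) ^ 3 + (\<mu> * real x / (1 - \<mu>))\<^sup>2" if "x \<le> K" for x
  proof (atomize (full), goal_cases)
    case 1
    show ?case
    proof (cases "x = 0")
      case True
      then show ?thesis
        by (simp add: gen_poisson_mean_0 if_distrib[of "\<lambda>y. _ * y"] cong: if_cong)
    next
      case False
      then have "K - x < K" using that by simp
      from less.IH[OF this, of "\<mu> * real x"] assms show ?thesis by simp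
    qed
  qed
  have p: "0 \<le> gen_poisson 0 \<theta> x" for x
    using less.prems by (simp add: gen_poisson_nonneg)
  have mu1: "0 < 1 - \<mu>" using assms by simp
  have b1: "(\<Sum>j\<le>K - x. real (x + j) * gen_poisson \<mu> (\<mu> * real x) j) \<le> real x / (1 - \<mu>)"
    if "x \<le> K" for x
  proof -
    have "(\<Sum>j\<le>K - x. real (x + j) * gen_poisson \<mu> (\<mu> * real x) j)
      = real x * (\<Sum>j\<le>K - x. gen_poisson \<mu> (\<mu> * real x) j)
        + (\<Sum>j\<le>K - x. real j * gen_poisson \<mu> (\<mu> * real x) j)"
      by (simp add: algebra_simps sum.distrib sum_distrib_left)
    also have "\<dots> \<le> real x * 1 + \<mu> * real x / (1 - \<mu>)"
      using IH[OF that] by (intro add_mono mult_left_mono) auto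
    also have "\<dots> = real x / (1 - \<mu>)" using mu1 by (simp add: field_simps)
    finally show ?thesis .
  qed
  have b2: "(\<Sum>j\<le>K - x. real (x + j) ^ 2 * gen_poisson \<mu> (\<mu> * real x) j)
      \<le> real x ^ 2 / (1 - \<mu>)\<^sup>2 + \<mu> * real x / (1 - \<mu>) ^ 3"
    if "x \<le> K" for x
  proof -
    have "(\<Sum>j\<le>K - x. real (x + j) ^ 2 * gen_poisson \<mu> (\<mu> * real x) j)
      = real x ^ 2 * (\<Sum>j\<le>K - x. gen_poisson \<mu> (\<mu> * real x) j)
        + 2 * real x * (\<Sum>j\<le>K - x. real j * gen_poisson \<mu> (\<mu> * real x) j)
        + (\<Sum>j\<le>K - x. real j ^ 2 * gen_poisson \<mu> (\<mu> * real x) j)"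
      by (simp add: algebra_simps sum.distrib sum_distrib_left power2_eq_square)
    also have "\<dots> \<le> real x ^ 2 * 1 + 2 * real x * (\<mu> * real x / (1 - \<mu>))
        + (\<mu> * real x / (1 - \<mu>) ^ 3 + (\<mu> * real x / (1 - \<mu>))\<^sup>2)"
      using IH[OF that] by (intro add_mono mult_left_mono) auto
    also have "\<dots> = real x ^ 2 * (1 + 2 * (\<mu> / (1 - \<mu>)) + (\<mu> / (1 - \<mu>))\<^sup>2) + \<mu> * real x / (1 - \<mu>) ^ 3"
      by (simp add: power2_eq_square algebra_simps)
    also have "1 + 2 * (\<mu> / (1 - \<mu>)) + (\<mu> / (1 - \<mu>))\<^sup>2 = (1 + \<mu> / (1 - \<mu>))\<^sup>2"
      by (simp add: power2_eq_square algebra_simps)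
    also have "1 + \<mu> / (1 - \<mu>) = 1 / (1 - \<mu>)" using mu1 by (simp add: field_simps)
    finally show ?thesis by (simp add: power_divide)
  qed
  have "(\<Sum>k\<le>K. gen_poisson \<mu> \<theta> k) \<le> 1"
  proof -
    have "(\<Sum>k\<le>K. gen_poisson \<mu> \<theta> k)
        = (\<Sum>x\<le>K. gen_poisson 0 \<theta> x * (\<Sum>j\<le>K - x. gen_poisson \<mu> (\<mu> * real x) j))"
      using gen_poisson_partial_sum[of "\<lambda>_. 1" \<mu> \<theta> K] by simp
    also have "\<dots> \<le> (\<Sum>x\<le>K. gen_poisson 0 \<theta> x * 1)"
      using IH p by (intro sum_mono mult_left_mono) auto
    also have "\<dots> \<le> 1" using poisson_partial_sums(1) less.prems by simp
    finally show ?thesis .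
  qed
  moreover have "(\<Sum>k\<le>K. real k * gen_poisson \<mu> \<theta> k) \<le> \<theta> / (1 - \<mu>)"
  proof -
    have "(\<Sum>k\<le>K. real k * gen_poisson \<mu> \<theta> k) \<le> (\<Sum>x\<le>K. gen_poisson 0 \<theta> x * (real x / (1 - \<mu>)))"
      unfolding gen_poisson_partial_sum[of real] using b1 p by (intro sum_mono mult_left_mono) auto
    also have "\<dots> = (\<Sum>x\<le>K. gen_poisson 0 \<theta> x * real x) / (1 - \<mu>)"
      by (simp add: sum_divide_distrib)
    also have "\<dots> \<le> \<theta> / (1 - \<mu>)"
      using poisson_partial_sums(2) less.prems mu1 by (intro divide_right_mono) auto
    finally show ?thesis .
  qed
  moreover have "(\<Sum>k\<le>K. real k ^ 2 * gen_poisson \<mu> \<theta> k) \<le> \<theta> / (1 - \<mu>) ^ 3 + (\<theta> / (1 - \<mu>))\<^sup>2"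
  proof -
    have "(\<Sum>k\<le>K. real k ^ 2 * gen_poisson \<mu> \<theta> k)
        \<le> (\<Sum>x\<le>K. gen_poisson 0 \<theta> x * (real x ^ 2 / (1 - \<mu>)\<^sup>2 + \<mu> * real x / (1 - \<mu>) ^ 3))"
      unfolding gen_poisson_partial_sum[of "\<lambda>k. real k ^ 2"]
      using b2 p by (intro sum_mono mult_left_mono) auto
    also have "\<dots> = (\<Sum>x\<le>K. gen_poisson 0 \<theta> x * real x ^ 2) / (1 - \<mu>)\<^sup>2
        + \<mu> * (\<Sum>x\<le>K. gen_poisson 0 \<theta> x * real x) / (1 - \<mu>) ^ 3"
      by (simp add: algebra_simps sum.distrib sum_distrib_left sum_divide_distrib)
    also have "\<dots> \<le> (\<theta> + \<theta>\<^sup>2) / (1 - \<mu>)\<^sup>2 + \<mu> * \<theta> / (1 - \<mu>) ^ 3"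
      using poisson_partial_sums(2,3) less.prems mu1 assms
      by (intro add_mono divide_right_mono mult_left_mono) auto
    also have "\<dots> = \<theta> / (1 - \<mu>) ^ 3 + (\<theta> / (1 - \<mu>))\<^sup>2"
    proof -
      have "\<theta> / (1 - \<mu>)\<^sup>2 + \<mu> * \<theta> / (1 - \<mu>) ^ 3 = \<theta> / (1 - \<mu>) ^ 3"
        using mu1 by (simp add: power2_eq_square power3_eq_cube divide_simps) (simp add: algebra_simps)
      then show ?thesis by (simp add: add_divide_distrib power_divide)
    qed
    finally show ?thesis .
  qed
  ultimately show ?case by blast
qed

lemma summable_gen_poisson:
  assumes "0 \<le> \<mu>" "\<mu> < 1" "0 \<le> \<theta>"
  shows "summable (gen_poisson \<mu> \<theta>)"
proof (rule summableI_nonneg_bounded)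
  show "(\<Sum>k<n. gen_poisson \<mu> \<theta> k) \<le> 1" for n
    using gen_poisson_partial_moments[OF assms, of n] gen_poisson_nonneg[OF assms(1,3)]
      sum_mono2[of "{..n}" "{..<n}" "gen_poisson \<mu> \<theta>"] by force
qed (simp add: gen_poisson_nonneg assms)

text \<open>The mass is the probability that all trees are finite, so subcriticality has to enter;
  it does so through \<open>\<mu> ^ n\<close> tending to 0.\<close>

lemma gen_poisson_sums_1:
  assumes "0 \<le> \<mu>" "\<mu> < 1" "0 \<le> \<theta>"
  shows "gen_poisson \<mu> \<theta> sums 1"
proof -
  define f where "f \<theta> = (\<Sum>k. gen_poisson \<mu> \<theta> k)" for \<theta>
  have le1: "f \<theta> \<le> 1" if "0 \<le> \<theta>" for \<theta>
    unfolding f_def using assms that gen_poisson_partial_moments[of \<mu> \<theta>]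
    by (intro LIMSEQ_le_const2[OF summable_LIMSEQ'[OF summable_gen_poisson]]) auto
  \<comment> \<open>A rectangular block of the double sum lies inside the triangle
    \<open>x + j \<le> K + L\<close>. An inequality therefore suffices, and no infinite sums are
    interchanged.\<close>
  have step: "(\<Sum>x\<le>K. gen_poisson 0 \<theta> x * f (\<mu> * real x)) \<le> f \<theta>" if "0 \<le> \<theta>" for K \<theta>
  proof (rule LIMSEQ_le_const2)
    show "(\<lambda>L. \<Sum>x\<le>K. gen_poisson 0 \<theta> x * (\<Sum>j\<le>L. gen_poisson \<mu> (\<mu> * real x) j))
        \<longlonglongrightarrow> (\<Sum>x\<le>K. gen_poisson 0 \<theta> x * f (\<mu> * real x))"
      unfolding f_def using assms
      by (intro tendsto_intros summable_LIMSEQ' summable_gen_poisson) auto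
    have "(\<Sum>x\<le>K. gen_poisson 0 \<theta> x * (\<Sum>j\<le>L. gen_poisson \<mu> (\<mu> * real x) j)) \<le> f \<theta>" for L
    proof -
      have "(\<Sum>x\<le>K. gen_poisson 0 \<theta> x * (\<Sum>j\<le>L. gen_poisson \<mu> (\<mu> * real x) j))
          \<le> (\<Sum>x\<le>K. gen_poisson 0 \<theta> x * (\<Sum>j\<le>K + L - x. gen_poisson \<mu> (\<mu> * real x) j))"
        using assms that
        by (intro sum_mono mult_left_mono sum_mono2) (auto simp: gen_poisson_nonneg)
      also have "\<dots> \<le> (\<Sum>x\<le>K + L. gen_poisson 0 \<theta> x * (\<Sum>j\<le>K + L - x. gen_poisson \<mu> (\<mu> * real x) j))"
        using assms that
        by (intro sum_mono2 mult_nonneg_nonneg sum_nonneg) (auto simp: gen_poisson_nonneg)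
      also have "\<dots> = (\<Sum>k\<le>K + L. gen_poisson \<mu> \<theta> k)"
        using gen_poisson_partial_sum[of "\<lambda>_. 1" \<mu> \<theta> "K + L"] by simp
      also have "\<dots> \<le> f \<theta>"
        unfolding f_def using assms that
        by (intro sum_le_suminf summable_gen_poisson) (auto simp: gen_poisson_nonneg)
      finally show ?thesis .
    qed
    then show "\<exists>N. \<forall>n\<ge>N. (\<Sum>x\<le>K. gen_poisson 0 \<theta> x * (\<Sum>j\<le>n. gen_poisson \<mu> (\<mu> * real x) j)) \<le> f \<theta>"
      by blast
  qed
  \<comment> \<open>Conditioning on the first generation shows that the mass defect \<open>1 - f \<theta>\<close>, at most linear in \<open>\<theta>\<close>,
    is contracted by the factor \<open>\<mu>\<close>.\<close>
  have lower: "1 - \<mu> ^ n * \<theta> \<le> f \<theta>" if "0 \<le> \<theta>" for n \<theta>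
    using that
  proof (induction n arbitrary: \<theta>)
    case 0
    have "exp (- \<theta>) = (\<Sum>k<1. gen_poisson \<mu> \<theta> k)" by simp
    also have "\<dots> \<le> f \<theta>" unfolding f_def using assms 0
      by (intro sum_le_suminf summable_gen_poisson) (auto simp: gen_poisson_nonneg)
    finally show ?case using exp_ge_add_one_self[of "- \<theta>"] by simp
  next
    case (Suc n)
    have lim: "(\<lambda>K. (\<Sum>x\<le>K. gen_poisson 0 \<theta> x) - \<mu> ^ Suc n * \<theta>) \<longlonglongrightarrow> 1 - \<mu> ^ Suc n * \<theta>"
    proof (intro tendsto_intros)
      have "(\<lambda>x. \<theta> ^ x /\<^sub>R fact x * exp (- \<theta>)) sums (exp \<theta> * exp (- \<theta>))"
        by (intro sums_mult2 exp_converges)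
      then have "gen_poisson 0 \<theta> sums 1"
        by (simp add: exp_add[symmetric] gen_poisson_mu_0[abs_def] divide_inverse mult_ac)
      then show "(\<lambda>K. \<Sum>x\<le>K. gen_poisson 0 \<theta> x) \<longlonglongrightarrow> 1"
        by (simp add: sums_def_le)
    qed
    have "(\<Sum>x\<le>K. gen_poisson 0 \<theta> x) - \<mu> ^ Suc n * \<theta> \<le> f \<theta>" for K
    proof -
      have "(\<Sum>x\<le>K. gen_poisson 0 \<theta> x) - \<mu> ^ Suc n * \<theta>
          \<le> (\<Sum>x\<le>K. gen_poisson 0 \<theta> x) - \<mu> ^ Suc n * (\<Sum>x\<le>K. gen_poisson 0 \<theta> x * real x)"
        using poisson_partial_sums(2)[OF Suc.prems, of K] assms
        by (intro diff_left_mono mult_left_mono) auto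
      also have "\<dots> = (\<Sum>x\<le>K. gen_poisson 0 \<theta> x * (1 - \<mu> ^ n * (\<mu> * real x)))"
        by (simp add: algebra_simps sum_subtractf sum_distrib_left)
      also have "\<dots> \<le> (\<Sum>x\<le>K. gen_poisson 0 \<theta> x * f (\<mu> * real x))"
        using assms Suc.prems by (intro sum_mono mult_left_mono Suc.IH) (auto simp: gen_poisson_nonneg)
      also have "\<dots> \<le> f \<theta>" by (rule step[OF Suc.prems])
      finally show ?thesis .
    qed
    then show ?case
      by (intro LIMSEQ_le_const2[OF lim]) blast
  qed
  have "(\<lambda>n. 1 - \<mu> ^ n * \<theta>) \<longlonglongrightarrow> 1 - 0 * \<theta>"
    using assms by (intro tendsto_intros LIMSEQ_power_zero) auto
  then have "1 - 0 * \<theta> \<le> f \<theta>"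
    by (rule LIMSEQ_le_const2) (use lower assms in blast)
  with le1[OF assms(3)] have "f \<theta> = 1" by simp
  with summable_gen_poisson[OF assms] show ?thesis
    unfolding f_def by (simp add: sums_iff)
qed

section \<open>From weights to probability mass functions and their moments\<close>

lemma nat_pmf_expectation:
  fixes p :: "nat pmf" and f :: "nat \<Rightarrow> real"
  shows nat_pmf_integrable_iff: "integrable (measure_pmf p) f \<longleftrightarrow> summable (\<lambda>k. \<bar>pmf p k * f k\<bar>)"
    and nat_pmf_expectation_eq: "integrable (measure_pmf p) f \<Longrightarrow>
      measure_pmf.expectation p f = (\<Sum>k. pmf p k * f k)"
proof -
  show *: "integrable (measure_pmf p) f \<longleftrightarrow> summable (\<lambda>k. \<bar>pmf p k * f k\<bar>)"
    unfolding measure_pmf_eq_density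
    by (subst integrable_density) (auto simp: integrable_count_space_nat_iff)
  assume "integrable (measure_pmf p) f"
  then have "integrable (count_space UNIV) (\<lambda>k. pmf p k * f k)"
    using * by (simp add: integrable_count_space_nat_iff)
  then show "measure_pmf.expectation p f = (\<Sum>k. pmf p k * f k)"
    unfolding measure_pmf_eq_density
    by (subst integral_density) (auto simp: integral_count_space_nat)
qed

lemma nat_pmf_integrableI_bounded:
  fixes p :: "nat pmf" and f :: "nat \<Rightarrow> real"
  assumes "\<And>k. 0 \<le> f k" and "\<And>K. (\<Sum>k\<le>K. f k * pmf p k) \<le> B"
  shows "integrable (measure_pmf p) f" "measure_pmf.expectation p f \<le> B"
proof -
  have s: "summable (\<lambda>k. pmf p k * f k)"
  proof (rule summableI_nonneg_bounded)
    show "(\<Sum>k<n. pmf p k * f k) \<le> B" for n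
      using assms(2)[of n] sum_mono2[of "{..n}" "{..<n}" "\<lambda>k. f k * pmf p k"] assms(1)
      by (force simp: mult.commute)
  qed (simp add: assms)
  then show "integrable (measure_pmf p) f"
    using assms(1) by (simp add: nat_pmf_integrable_iff abs_mult)
  from nat_pmf_expectation_eq[OF this] show "measure_pmf.expectation p f \<le> B"
    using assms(2)
    by (simp, intro LIMSEQ_le_const2[OF summable_LIMSEQ'[OF s]]) (auto simp: mult.commute)
qed

definition gen_poisson_pmf :: "real \<Rightarrow> real \<Rightarrow> nat pmf" where
  "gen_poisson_pmf \<mu> \<theta> = embed_pmf (gen_poisson \<mu> \<theta>)"

lemma pmf_gen_poisson:
  assumes "0 \<le> \<mu>" "\<mu> < 1" "0 \<le> \<theta>"
  shows "pmf (gen_poisson_pmf \<mu> \<theta>) k = gen_poisson \<mu> \<theta> k"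
  unfolding gen_poisson_pmf_def
proof (rule pmf_embed_pmf)
  show "0 \<le> gen_poisson \<mu> \<theta> k" for k
    using assms by (simp add: gen_poisson_nonneg)
  show "(\<integral>\<^sup>+x. ennreal (gen_poisson \<mu> \<theta> x) \<partial>count_space UNIV) = 1"
    using gen_poisson_sums_1[OF assms] assms
    by (simp add: nn_integral_count_space_nat suminf_ennreal2 gen_poisson_nonneg sums_iff)
qed

lemma gen_poisson_pmf_0:
  assumes "0 < \<theta>"
  shows "gen_poisson_pmf 0 \<theta> = poisson_pmf \<theta>"
  using assms by (intro pmf_eqI) (simp add: pmf_gen_poisson gen_poisson_mu_0)

lemma pmf_map_add: "pmf (map_pmf ((+) x) p) k = (if x \<le> k then pmf p (k - x) else 0)"
  for p :: "nat pmf"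
proof (cases "x \<le> k")
  case True
  then have "pmf (map_pmf ((+) x) p) k = pmf (map_pmf ((+) x) p) (x + (k - x))" by simp
  also have "\<dots> = pmf p (k - x)" by (rule pmf_map_inj') simp
  finally show ?thesis using True by simp
next
  case False
  then show ?thesis by (auto simp: pmf_eq_0_set_pmf)
qed

text \<open>The convolution identity as a statement about sampling in two stages;
  \<open>\<delta> \<le> \<mu>\<close> keeps the second parameter nonnegative. The case
  \<open>\<delta> = 0\<close> later performs one step of the Hawkes process.\<close>

lemma gen_poisson_pmf_bind:
  assumes "0 \<le> \<delta>" "\<delta> \<le> \<mu>" "\<mu> < 1" "0 \<le> a" "0 \<le> b"
  shows "bind_pmf (gen_poisson_pmf \<delta> a)
      (\<lambda>x. map_pmf ((+) x) (gen_poisson_pmf \<mu> (b + (\<mu> - \<delta>) * real x))) = gen_poisson_pmf \<mu> (a + b)"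
proof (rule pmf_eqI)
  fix k
  have "pmf (bind_pmf (gen_poisson_pmf \<delta> a)
      (\<lambda>x. map_pmf ((+) x) (gen_poisson_pmf \<mu> (b + (\<mu> - \<delta>) * real x)))) k
    = (\<Sum>x\<le>k. pmf (map_pmf ((+) x) (gen_poisson_pmf \<mu> (b + (\<mu> - \<delta>) * real x))) k
        * pmf (gen_poisson_pmf \<delta> a) x)"
    unfolding pmf_bind by (rule integral_measure_pmf_real) (auto simp: pmf_map_add split: if_splits)
  also have "\<dots> = (\<Sum>x\<le>k. gen_poisson \<delta> a x * gen_poisson \<mu> (b + (\<mu> - \<delta>) * real x) (k - x))"
    using assms by (intro sum.cong) (auto simp: pmf_map_add pmf_gen_poisson)
  also have "\<dots> = pmf (gen_poisson_pmf \<mu> (a + b)) k"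
    using assms by (simp add: gen_poisson_convolution pmf_gen_poisson)
  finally show "pmf (bind_pmf (gen_poisson_pmf \<delta> a)
      (\<lambda>x. map_pmf ((+) x) (gen_poisson_pmf \<mu> (b + (\<mu> - \<delta>) * real x)))) k
    = pmf (gen_poisson_pmf \<mu> (a + b)) k" .
qed

lemma gen_poisson_pmf_add:
  assumes "0 \<le> \<mu>" "\<mu> < 1" "0 \<le> a" "0 \<le> b"
  shows "gen_poisson_pmf \<mu> (a + b)
    = map_pmf (\<lambda>z. fst z + snd z) (pair_pmf (gen_poisson_pmf \<mu> a) (gen_poisson_pmf \<mu> b))"
  using gen_poisson_pmf_bind[of \<mu> \<mu> a b] assms
  by (simp add: pair_pmf_def map_bind_pmf map_pmf_def bind_assoc_pmf bind_return_pmf)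

lemma gen_poisson_moments:
  assumes "0 \<le> \<mu>" "\<mu> < 1" "0 \<le> \<theta>"
  shows integrable_gen_poisson: "integrable (gen_poisson_pmf \<mu> \<theta>) real"
    and integrable_gen_poisson_sq: "integrable (gen_poisson_pmf \<mu> \<theta>) (\<lambda>k. (real k)\<^sup>2)"
    and gen_poisson_mean_le: "measure_pmf.expectation (gen_poisson_pmf \<mu> \<theta>) real \<le> \<theta> / (1 - \<mu>)"
    and gen_poisson_sq_le: "measure_pmf.expectation (gen_poisson_pmf \<mu> \<theta>) (\<lambda>k. (real k)\<^sup>2)
      \<le> \<theta> / (1 - \<mu>) ^ 3 + (\<theta> / (1 - \<mu>))\<^sup>2"
  using gen_poisson_partial_moments[OF assms]
    nat_pmf_integrableI_bounded[of real "gen_poisson_pmf \<mu> \<theta>" "\<theta> / (1 - \<mu>)"]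
    nat_pmf_integrableI_bounded[of "\<lambda>k. (real k)\<^sup>2" "gen_poisson_pmf \<mu> \<theta>"
      "\<theta> / (1 - \<mu>) ^ 3 + (\<theta> / (1 - \<mu>))\<^sup>2"]
  by (simp_all add: pmf_gen_poisson[OF assms])

text \<open>Summation of \<open>gen_poisson_size_bias\<close> against \<open>h\<close>. The factor
  \<open>k\<close> kills the term at 0, so the index can be shifted; boundedness of \<open>h\<close>
  reduces integrability to finite means.\<close>

lemma gen_poisson_size_bias_expectation:
  assumes "0 \<le> \<mu>" "\<mu> < 1" "0 < \<theta>" and h: "\<And>k. \<bar>h k\<bar> \<le> A"
  shows "(\<theta> + \<mu>) * measure_pmf.expectation (gen_poisson_pmf \<mu> \<theta>) (\<lambda>k. real k * h k)
    = \<theta> * measure_pmf.expectation (gen_poisson_pmf \<mu> (\<theta> + \<mu>))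
        (\<lambda>k. (\<theta> + \<mu> * (real k + 1)) * h (Suc k))" (is "_ = \<theta> * ?E")
proof -
  have i: "integrable (gen_poisson_pmf \<mu> \<theta>) (\<lambda>k. real k * h k)"
  proof (rule Bochner_Integration.integrable_bound[of _ "\<lambda>k. A * real k"])
    show "integrable (gen_poisson_pmf \<mu> \<theta>) (\<lambda>k. A * real k)"
      using assms integrable_gen_poisson[of \<mu> \<theta>] by simp
    show "AE k in gen_poisson_pmf \<mu> \<theta>. norm (real k * h k) \<le> norm (A * real k)"
      using h[THEN order_trans, OF abs_ge_self]
      by (intro AE_pmfI) (simp add: abs_mult mult.commute[of "real _"] mult_right_mono)
  qed simp
  have i': "integrable (gen_poisson_pmf \<mu> (\<theta> + \<mu>)) (\<lambda>k. (\<theta> + \<mu> * (real k + 1)) * h (Suc k))"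
  proof (rule Bochner_Integration.integrable_bound[of _ "\<lambda>k. (\<theta> + \<mu> * (real k + 1)) * A"])
    show "integrable (gen_poisson_pmf \<mu> (\<theta> + \<mu>)) (\<lambda>k. (\<theta> + \<mu> * (real k + 1)) * A)"
      using assms integrable_gen_poisson[of \<mu> "\<theta> + \<mu>"]
      by (auto intro!: integrable_mult_left Bochner_Integration.integrable_add integrable_mult_right)
    show "AE k in gen_poisson_pmf \<mu> (\<theta> + \<mu>). norm ((\<theta> + \<mu> * (real k + 1)) * h (Suc k))
        \<le> norm ((\<theta> + \<mu> * (real k + 1)) * A)"
    proof (rule AE_pmfI)
      fix k
      have "\<bar>h (Suc k)\<bar> \<le> \<bar>A\<bar>" using h[of "Suc k"] by simp
      then show "norm ((\<theta> + \<mu> * (real k + 1)) * h (Suc k)) \<le> norm ((\<theta> + \<mu> * (real k + 1)) * A)"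
        by (simp add: abs_mult mult_left_mono)
    qed
  qed simp
  have s: "summable (\<lambda>k. gen_poisson \<mu> \<theta> k * (real k * h k))"
    using i assms by (auto simp: nat_pmf_integrable_iff pmf_gen_poisson intro: summable_rabs_cancel)
  have s': "summable (\<lambda>k. gen_poisson \<mu> (\<theta> + \<mu>) k * ((\<theta> + \<mu> * (real k + 1)) * h (Suc k)))"
    using i' assms by (auto simp: nat_pmf_integrable_iff pmf_gen_poisson intro: summable_rabs_cancel)
  have "(\<theta> + \<mu>) * measure_pmf.expectation (gen_poisson_pmf \<mu> \<theta>) (\<lambda>k. real k * h k)
      = (\<Sum>k. (\<theta> + \<mu>) * (gen_poisson \<mu> \<theta> (Suc k) * (real (Suc k) * h (Suc k))))"
    using i s assms suminf_split_head[OF s]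
    by (simp add: nat_pmf_expectation_eq pmf_gen_poisson suminf_mult summable_Suc_iff[of "\<lambda>k. gen_poisson \<mu> \<theta> k * (real k * h k)"] del: of_nat_Suc)
  also have "\<dots> = (\<Sum>k. \<theta> * (gen_poisson \<mu> (\<theta> + \<mu>) k * ((\<theta> + \<mu> * (real k + 1)) * h (Suc k))))"
  proof (rule suminf_cong)
    fix k
    have "(\<theta> + \<mu>) * (gen_poisson \<mu> \<theta> (Suc k) * (real (Suc k) * h (Suc k)))
        = ((\<theta> + \<mu>) * (real (Suc k) * gen_poisson \<mu> \<theta> (Suc k))) * h (Suc k)"
      by (simp only: mult_ac)
    also have "\<dots> = \<theta> * (gen_poisson \<mu> (\<theta> + \<mu>) k * ((\<theta> + \<mu> * (real k + 1)) * h (Suc k)))"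
      unfolding gen_poisson_size_bias[OF assms(1,3)] by (simp add: mult_ac add_ac)
    finally show "(\<theta> + \<mu>) * (gen_poisson \<mu> \<theta> (Suc k) * (real (Suc k) * h (Suc k)))
      = \<theta> * (gen_poisson \<mu> (\<theta> + \<mu>) k * ((\<theta> + \<mu> * (real k + 1)) * h (Suc k)))" .
  qed
  also have "\<dots> = \<theta> * ?E"
    using i' s' assms by (simp add: nat_pmf_expectation_eq pmf_gen_poisson suminf_mult)
  finally show ?thesis .
qed

text \<open>The size-bias identity with \<open>h = 1\<close> relates the means at
  \<open>\<theta>\<close> and \<open>\<theta> + \<mu>\<close>. The normalized mean
  \<open>\<rho>\<close> satisfies
  \<open>\<rho> \<theta> = 1 + \<mu> * \<rho> (\<theta> + \<mu>)\<close> and lies between 0 and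
  \<open>1 / (1 - \<mu>)\<close>. Iteration contracts the distance to the fixed point
  \<open>1 / (1 - \<mu>)\<close> by \<open>\<mu>\<close> each time.\<close>

lemma gen_poisson_mean:
  assumes "0 \<le> \<mu>" "\<mu> < 1" "0 \<le> \<theta>"
  shows "measure_pmf.expectation (gen_poisson_pmf \<mu> \<theta>) real = \<theta> / (1 - \<mu>)"
proof (cases "\<theta> = 0")
  case True
  have "0 \<le> measure_pmf.expectation (gen_poisson_pmf \<mu> \<theta>) real" by simp
  with gen_poisson_mean_le[OF assms] True show ?thesis by (simp add: antisym)
next
  case False
  define \<rho> where "\<rho> \<theta> = measure_pmf.expectation (gen_poisson_pmf \<mu> \<theta>) real / \<theta>" for \<theta>
  have rec: "\<rho> \<theta> = 1 + \<mu> * \<rho> (\<theta> + \<mu>)" if "0 < \<theta>" for \<theta>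
  proof -
    let ?m = "measure_pmf.expectation (gen_poisson_pmf \<mu> (\<theta> + \<mu>)) real"
    have "(\<theta> + \<mu>) * measure_pmf.expectation (gen_poisson_pmf \<mu> \<theta>) real
      = \<theta> * measure_pmf.expectation (gen_poisson_pmf \<mu> (\<theta> + \<mu>)) (\<lambda>k. \<theta> + \<mu> * (real k + 1))"
      using gen_poisson_size_bias_expectation[of \<mu> \<theta> "\<lambda>_. 1" 1] assms that by simp
    also have "measure_pmf.expectation (gen_poisson_pmf \<mu> (\<theta> + \<mu>)) (\<lambda>k. \<theta> + \<mu> * (real k + 1))
      = \<theta> + \<mu> * (?m + 1)"
      using integrable_gen_poisson[of \<mu> "\<theta> + \<mu>"] assms that by simp
    finally show ?thesis
      using that assms by (simp add: \<rho>_def field_simps)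
  qed
  have bound: "\<bar>\<rho> \<theta> - 1 / (1 - \<mu>)\<bar> \<le> \<mu> ^ n / (1 - \<mu>)" if "0 < \<theta>" for n \<theta>
    using that
  proof (induction n arbitrary: \<theta>)
    case 0
    have "0 \<le> \<rho> \<theta>" unfolding \<rho>_def using 0 by simp
    moreover have "\<rho> \<theta> \<le> 1 / (1 - \<mu>)"
      using gen_poisson_mean_le[of \<mu> \<theta>] 0 assms by (simp add: \<rho>_def field_simps)
    ultimately show ?case by simp
  next
    case (Suc n)
    have "\<rho> \<theta> - 1 / (1 - \<mu>) = \<mu> * (\<rho> (\<theta> + \<mu>) - 1 / (1 - \<mu>))"
      unfolding rec[OF Suc.prems] using assms by (simp add: field_simps)
    then have "\<bar>\<rho> \<theta> - 1 / (1 - \<mu>)\<bar> = \<mu> * \<bar>\<rho> (\<theta> + \<mu>) - 1 / (1 - \<mu>)\<bar>"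
      using assms by (simp add: abs_mult)
    also have "\<dots> \<le> \<mu> * (\<mu> ^ n / (1 - \<mu>))"
      using assms Suc.prems by (intro mult_left_mono Suc.IH) auto
    finally show ?case by simp
  qed
  have "(\<lambda>n. \<mu> ^ n / (1 - \<mu>)) \<longlonglongrightarrow> 0 / (1 - \<mu>)"
    using assms by (intro tendsto_intros LIMSEQ_power_zero) auto
  then have "\<bar>\<rho> \<theta> - 1 / (1 - \<mu>)\<bar> \<le> 0 / (1 - \<mu>)"
    by (rule LIMSEQ_le_const) (use bound[of \<theta>] False assms in auto)
  then show ?thesis
    using False by (simp add: \<rho>_def field_simps)
qed

lemma nn_integral_gen_poisson_affine:
  assumes "0 \<le> \<nu>" "\<nu> < 1" "0 \<le> \<theta>" "0 \<le> a" "0 \<le> b"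
  shows "(\<integral>\<^sup>+j. ennreal (a + b * real j) \<partial>gen_poisson_pmf \<nu> \<theta>) = ennreal (a + b * (\<theta> / (1 - \<nu>)))"
  using assms integrable_gen_poisson[of \<nu> \<theta>] gen_poisson_mean[of \<nu> \<theta>]
  by (subst nn_integral_eq_integral) auto

text \<open>The square in the second moment bound cancels only against the exact mean; an upper
  bound on the mean would enter with the wrong sign.\<close>

lemma gen_poisson_variance_le:
  assumes "0 \<le> \<mu>" "\<mu> < 1" "0 \<le> \<theta>"
  shows "measure_pmf.expectation (gen_poisson_pmf \<mu> \<theta>) (\<lambda>k. (real k - \<theta> / (1 - \<mu>))\<^sup>2)
    \<le> \<theta> / (1 - \<mu>) ^ 3"
proof -
  define m where "m = \<theta> / (1 - \<mu>)"
  have "measure_pmf.expectation (gen_poisson_pmf \<mu> \<theta>) (\<lambda>k. (real k - m)\<^sup>2)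
    = measure_pmf.expectation (gen_poisson_pmf \<mu> \<theta>) (\<lambda>k. (real k)\<^sup>2 - 2 * m * real k + m\<^sup>2)"
    by (simp add: power2_diff mult_ac diff_add_eq)
  also have "\<dots> = measure_pmf.expectation (gen_poisson_pmf \<mu> \<theta>) (\<lambda>k. (real k)\<^sup>2) - 2 * m * m + m\<^sup>2"
    using integrable_gen_poisson[OF assms] integrable_gen_poisson_sq[OF assms]
    by (simp add: gen_poisson_mean[OF assms] m_def)
  also have "\<dots> \<le> \<theta> / (1 - \<mu>) ^ 3"
    using gen_poisson_sq_le[OF assms] by (simp add: m_def power2_eq_square)
  finally show ?thesis by (simp add: m_def)
qed

section \<open>Approximate Stein identity\<close>

lemma pair_pmf_expectation_mult:
  fixes f :: "'a \<Rightarrow> real" and g :: "'b \<Rightarrow> real"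
  assumes f: "integrable (measure_pmf p) f" and g: "integrable (measure_pmf q) g"
    and g0: "\<And>y. 0 \<le> g y"
  shows "integrable (pair_pmf p q) (\<lambda>z. f (fst z) * g (snd z))"
    and "measure_pmf.expectation (pair_pmf p q) (\<lambda>z. f (fst z) * g (snd z))
      = measure_pmf.expectation p f * measure_pmf.expectation q g"
proof -
  have *: "integrable (pair_pmf p q) (\<lambda>z. f (fst z) * g (snd z)) \<and>
      measure_pmf.expectation (pair_pmf p q) (\<lambda>z. f (fst z) * g (snd z))
      = measure_pmf.expectation p f * measure_pmf.expectation q g"
    if f: "integrable (measure_pmf p) f" and f0: "\<And>x. 0 \<le> f x" for f :: "'a \<Rightarrow> real"
  proof -
    have "(\<integral>\<^sup>+z. ennreal (f (fst z) * g (snd z)) \<partial>pair_pmf p q)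
        = (\<integral>\<^sup>+x. ennreal (f x) * (\<integral>\<^sup>+y. ennreal (g y) \<partial>measure_pmf q) \<partial>measure_pmf p)"
      by (simp add: nn_integral_pair_pmf' ennreal_mult f0 g0 nn_integral_cmult)
    also have "\<dots> = (\<integral>\<^sup>+x. ennreal (f x) \<partial>measure_pmf p) * (\<integral>\<^sup>+y. ennreal (g y) \<partial>measure_pmf q)"
      by (rule nn_integral_multc) simp
    also have "\<dots> = ennreal (measure_pmf.expectation p f * measure_pmf.expectation q g)"
      using f g f0 g0 by (simp add: nn_integral_eq_integral ennreal_mult)
    finally have "has_bochner_integral (pair_pmf p q) (\<lambda>z. f (fst z) * g (snd z))
        (measure_pmf.expectation p f * measure_pmf.expectation q g)"
      by (intro has_bochner_integral_nn_integral) (auto simp: f0 g0)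
    then show ?thesis
      by (simp add: has_bochner_integral_iff)
  qed
  have p: "integrable p (\<lambda>x. max 0 (f x))" "integrable p (\<lambda>x. max 0 (- f x))"
    using f by auto
  have eq: "f x = max 0 (f x) - max 0 (- f x)" for x by (simp add: max_def)
  have eq2: "f (fst z) * g (snd z)
      = max 0 (f (fst z)) * g (snd z) - max 0 (- f (fst z)) * g (snd z)" for z
    by (subst eq) (simp add: algebra_simps)
  show "integrable (pair_pmf p q) (\<lambda>z. f (fst z) * g (snd z))"
    unfolding eq2 using *[OF p(1)] *[OF p(2)]
    by (intro Bochner_Integration.integrable_diff) auto
  have "measure_pmf.expectation p f = measure_pmf.expectation p (\<lambda>x. max 0 (f x) - max 0 (- f x))"
    by (rule Bochner_Integration.integral_cong) (simp_all add: max_def)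
  also have "\<dots> = measure_pmf.expectation p (\<lambda>x. max 0 (f x))
      - measure_pmf.expectation p (\<lambda>x. max 0 (- f x))"
    by (rule Bochner_Integration.integral_diff[OF p])
  finally have "measure_pmf.expectation p f
      = measure_pmf.expectation p (\<lambda>x. max 0 (f x)) - measure_pmf.expectation p (\<lambda>x. max 0 (- f x))" .
  then show "measure_pmf.expectation (pair_pmf p q) (\<lambda>z. f (fst z) * g (snd z))
      = measure_pmf.expectation p f * measure_pmf.expectation q g"
    unfolding eq2 using *[OF p(1)] *[OF p(2)] by (simp add: left_diff_distrib)
qed

text \<open>With \<open>D\<close> of parameter \<open>\<theta>\<close> and \<open>B - 1\<close>
  independent of parameter \<open>\<mu>\<close>, the size bias gives \<open>(\<theta> + \<mu>) *
  E[D h(D)] = \<theta> * E[(\<theta> + \<mu> * (D + B)) * h(D + B)]\<close>. Expanding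
  \<open>h(D + B)\<close> at \<open>D\<close> yields the main terms. The \<open>A\<close> term
  collects the prefactor \<open>\<theta> + \<mu>\<close> against \<open>\<theta>\<close> and the
  summand \<open>\<mu> * B\<close>, the \<open>C\<close> term is the Taylor remainder, and the
  \<open>B\<close> term comes from replacing \<open>\<theta> + \<mu> * D\<close> by its mean
  \<open>m\<close> in front of \<open>h'\<close>.\<close>

lemma gen_poisson_stein:
  fixes h h' :: "real \<Rightarrow> real"
  assumes \<mu>: "0 \<le> \<mu>" "\<mu> < 1" and \<theta>: "0 < \<theta>"
    and deriv: "\<And>x. (h has_real_derivative h' x) (at x)"
    and h: "\<And>x. \<bar>h x\<bar> \<le> A" and h': "\<And>x. \<bar>h' x\<bar> \<le> B"
    and lip: "\<And>x y. \<bar>h' x - h' y\<bar> \<le> C * \<bar>x - y\<bar>"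
    and m: "m = \<theta> / (1 - \<mu>)"
  shows "(1 - \<mu>) * \<bar>measure_pmf.expectation (gen_poisson_pmf \<mu> \<theta>) (\<lambda>k. (real k - m) * h (real k))
      - m / (1 - \<mu>)\<^sup>2 * measure_pmf.expectation (gen_poisson_pmf \<mu> \<theta>) (\<lambda>k. h' (real k))\<bar>
    \<le> 2 * \<mu> * A / (1 - \<mu>) + C * m / (1 - \<mu>) ^ 3 + \<mu> / (1 - \<mu>) * B * sqrt (\<theta> / (1 - \<mu>) ^ 3)"
proof -
  define q where "q = 1 / (1 - \<mu>)"
  have mq: "m = \<theta> * q" by (simp add: m q_def)
  have q: "0 < q" "q * (1 - \<mu>) = 1" using \<mu> by (auto simp: q_def)
  have m_fix: "\<theta> + \<mu> * m = m" using \<mu> by (simp add: m field_simps)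
  have m0: "0 < m" using \<theta> q by (simp add: mq)
  have A0: "0 \<le> A" using h[of 0] by simp
  have B0: "0 \<le> B" using h'[of 0] by simp
  have C0: "0 \<le> C" using lip[of 1 0] by simp
  define P where "P = gen_poisson_pmf \<mu> \<theta>"
  define Q where "Q = gen_poisson_pmf \<mu> \<mu>"
  \<comment> \<open>Everything in \<open>(\<theta> + \<mu> * (D + B)) * h (D + B)\<close> beyond
    \<open>(\<theta> + \<mu> * D) * (h D + B * h' D)\<close>, with \<open>D = fst z\<close> and
    \<open>B = snd z + 1\<close>.\<close>
  define R where "R z = \<mu> * (real (snd z) + 1) * h (real (fst z) + (real (snd z) + 1))
    + (\<theta> + \<mu> * real (fst z)) * (h (real (fst z) + (real (snd z) + 1)) - h (real (fst z))
        - (real (snd z) + 1) * h' (real (fst z)))" for z :: "nat \<times> nat"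
  have iP: "integrable P real" and EP: "measure_pmf.expectation P real = m"
    unfolding P_def m using integrable_gen_poisson gen_poisson_mean \<mu> \<theta> by auto
  \<comment> \<open>Under \<open>Q\<close>, the variable \<open>k + 1\<close> is the size of one
    tree: the root and the progeny of its Poisson(\<open>\<mu>\<close>) children.\<close>
  have iQ: "integrable Q (\<lambda>k. real k + 1)" and EQ: "measure_pmf.expectation Q (\<lambda>k. real k + 1) = q"
    unfolding Q_def q_def using integrable_gen_poisson[of \<mu> \<mu>] gen_poisson_mean[of \<mu> \<mu>] \<mu>
    by (auto simp: field_simps)
  have iQ2: "integrable Q (\<lambda>k. (real k + 1)\<^sup>2)"
    and EQ2: "measure_pmf.expectation Q (\<lambda>k. (real k + 1)\<^sup>2) \<le> q ^ 3"
  proof -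
    note i = integrable_gen_poisson[of \<mu> \<mu>, OF \<mu> \<mu>(1)] integrable_gen_poisson_sq[of \<mu> \<mu>, OF \<mu> \<mu>(1)]
    have e: "(real k + 1)\<^sup>2 = (real k)\<^sup>2 + 2 * real k + 1" for k
      by (simp add: power2_sum)
    show "integrable Q (\<lambda>k. (real k + 1)\<^sup>2)"
      unfolding e Q_def using i by auto
    have "measure_pmf.expectation Q (\<lambda>k. (real k + 1)\<^sup>2)
        = measure_pmf.expectation Q (\<lambda>k. (real k)\<^sup>2) + 2 * (\<mu> / (1 - \<mu>)) + 1"
      unfolding e Q_def using i gen_poisson_mean[of \<mu> \<mu>] \<mu> by simp
    also have "\<dots> \<le> \<mu> / (1 - \<mu>) ^ 3 + (\<mu> / (1 - \<mu>))\<^sup>2 + 2 * (\<mu> / (1 - \<mu>)) + 1"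
      using gen_poisson_sq_le[of \<mu> \<mu>] \<mu> by (simp add: Q_def)
    also have "\<dots> = q ^ 3"
      using \<mu> by (simp add: q_def power2_eq_square power3_eq_cube divide_simps) (simp add: algebra_simps)
    finally show "measure_pmf.expectation Q (\<lambda>k. (real k + 1)\<^sup>2) \<le> q ^ 3" .
  qed
  have lin: "integrable P (\<lambda>k. (c + d * real k) * u (real k))" if "\<And>x. \<bar>u x\<bar> \<le> K" for c d K u
  proof (rule Bochner_Integration.integrable_bound[of _ "\<lambda>k. (\<bar>c\<bar> + \<bar>d\<bar> * real k) * K"])
    show "integrable P (\<lambda>k. (\<bar>c\<bar> + \<bar>d\<bar> * real k) * K)"
      using iP by (intro integrable_mult_left Bochner_Integration.integrable_add integrable_mult_right) auto
    have "\<bar>(c + d * real k) * u (real k)\<bar> \<le> (\<bar>c\<bar> + \<bar>d\<bar> * real k) * K" for k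
      unfolding abs_mult
      by (intro mult_mono that order_trans[OF abs_triangle_ineq]) (auto simp: abs_mult)
    then show "AE k in P. norm ((c + d * real k) * u (real k)) \<le> norm ((\<bar>c\<bar> + \<bar>d\<bar> * real k) * K)"
      by (intro AE_pmfI) (simp add: order_trans[OF _ abs_ge_self])
  qed simp
  have i1: "integrable P (\<lambda>k. (\<theta> + \<mu> * real k) * h (real k))"
    and i2: "integrable P (\<lambda>k. (\<theta> + \<mu> * real k) * h' (real k))"
    and i3: "integrable P (\<lambda>k. real k * h (real k))"
    and i4: "integrable P (\<lambda>k. (real k - m) * h' (real k))"
    and i5: "integrable P (\<lambda>k. h' (real k))"
    and i6: "integrable P (\<lambda>k. \<theta> + \<mu> * real k)"
    using lin[OF h, of \<theta> \<mu>] lin[OF h', of \<theta> \<mu>] lin[OF h, of 0 1] lin[OF h', of "- m" 1]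
      lin[OF h', of 1 0] lin[of "\<lambda>_. 1" 1 \<theta> \<mu>] by simp_all
  have Rbound: "\<bar>R z\<bar> \<le> \<mu> * A * (real (snd z) + 1)
      + C * ((\<theta> + \<mu> * real (fst z)) * (real (snd z) + 1)\<^sup>2)" for z
  proof -
    define d where "d = real (fst z)"
    define b where "b = real (snd z) + 1"
    have b: "0 < b" and d: "0 \<le> d" by (auto simp: b_def d_def)
    \<comment> \<open>Only a Lipschitz bound on \<open>h'\<close> is at hand, so the mean value
      theorem replaces a second-order expansion, with \<open>C\<close> in place of
      \<open>C / 2\<close>.\<close>
    obtain \<xi> where \<xi>: "d < \<xi>" "\<xi> < d + b" "h (d + b) - h d = (d + b - d) * h' \<xi>"
      using MVT2[of d "d + b" h h'] b deriv by auto
    have "\<bar>h (d + b) - h d - b * h' d\<bar> = b * \<bar>h' \<xi> - h' d\<bar>"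
      using \<xi>(3) b by (simp add: abs_mult right_diff_distrib[symmetric])
    also have "\<dots> \<le> b * (C * b)"
      using b \<xi> C0 by (intro mult_left_mono order_trans[OF lip] mult_left_mono) auto
    finally have 1: "\<bar>h (d + b) - h d - b * h' d\<bar> \<le> C * b\<^sup>2"
      by (simp add: power2_eq_square mult_ac)
    have "\<bar>R z\<bar> \<le> \<bar>\<mu> * b * h (d + b)\<bar> + \<bar>(\<theta> + \<mu> * d) * (h (d + b) - h d - b * h' d)\<bar>"
      unfolding R_def d_def[symmetric] b_def[symmetric] by (rule abs_triangle_ineq)
    also have "\<dots> \<le> \<mu> * b * A + (\<theta> + \<mu> * d) * (C * b\<^sup>2)"
      unfolding abs_mult using \<mu> b d \<theta> h 1 by (intro add_mono mult_mono) auto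
    finally show ?thesis by (simp add: d_def b_def mult_ac)
  qed
  have iR0: "integrable (pair_pmf P Q) (\<lambda>z. \<mu> * A * (real (snd z) + 1)
      + C * ((\<theta> + \<mu> * real (fst z)) * (real (snd z) + 1)\<^sup>2))"
    and ER0: "measure_pmf.expectation (pair_pmf P Q) (\<lambda>z. \<mu> * A * (real (snd z) + 1)
      + C * ((\<theta> + \<mu> * real (fst z)) * (real (snd z) + 1)\<^sup>2)) \<le> \<mu> * A * q + C * (m * q ^ 3)"
  proof -
    have a1: "integrable (pair_pmf P Q) (\<lambda>z. real (snd z) + 1)"
      "measure_pmf.expectation (pair_pmf P Q) (\<lambda>z. real (snd z) + 1) = q"
      using pair_pmf_expectation_mult[of P "\<lambda>_. 1" Q "\<lambda>k. real k + 1"] iQ EQ by auto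
    have a2: "integrable (pair_pmf P Q) (\<lambda>z. (\<theta> + \<mu> * real (fst z)) * (real (snd z) + 1)\<^sup>2)"
      "measure_pmf.expectation (pair_pmf P Q) (\<lambda>z. (\<theta> + \<mu> * real (fst z)) * (real (snd z) + 1)\<^sup>2)
        = m * measure_pmf.expectation Q (\<lambda>k. (real k + 1)\<^sup>2)"
      using pair_pmf_expectation_mult[of P "\<lambda>k. \<theta> + \<mu> * real k" Q "\<lambda>k. (real k + 1)\<^sup>2"] iQ2 i6 iP
      by (auto simp: EP m_fix)
    show "integrable (pair_pmf P Q) (\<lambda>z. \<mu> * A * (real (snd z) + 1)
      + C * ((\<theta> + \<mu> * real (fst z)) * (real (snd z) + 1)\<^sup>2))"
      by (rule Bochner_Integration.integrable_add[OF integrable_mult_right[OF a1(1)]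
            integrable_mult_right[OF a2(1)]])
    show "measure_pmf.expectation (pair_pmf P Q) (\<lambda>z. \<mu> * A * (real (snd z) + 1)
      + C * ((\<theta> + \<mu> * real (fst z)) * (real (snd z) + 1)\<^sup>2)) \<le> \<mu> * A * q + C * (m * q ^ 3)"
      using EQ2 C0 m0
      unfolding Bochner_Integration.integral_add[OF integrable_mult_right[OF a1(1)]
          integrable_mult_right[OF a2(1)]] integral_mult_right_zero a1(2) a2(2)
      by (simp add: mult_left_mono)
  qed
  have iR: "integrable (pair_pmf P Q) R"
    by (rule Bochner_Integration.integrable_bound[OF iR0]) (use Rbound in \<open>auto intro!: AE_pmfI intro: order_trans[OF _ abs_ge_self]\<close>)
  have ER: "\<bar>measure_pmf.expectation (pair_pmf P Q) R\<bar> \<le> \<mu> * A * q + C * (m * q ^ 3)"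
  proof -
    have "\<bar>measure_pmf.expectation (pair_pmf P Q) R\<bar>
        \<le> measure_pmf.expectation (pair_pmf P Q) (\<lambda>z. \<bar>R z\<bar>)"
      by (rule integral_abs_bound)
    also have "\<dots> \<le> \<mu> * A * q + C * (m * q ^ 3)"
      by (rule order_trans[OF integral_mono ER0]) (use iR iR0 Rbound in auto)
    finally show ?thesis .
  qed
  have "(\<theta> + \<mu>) * measure_pmf.expectation P (\<lambda>k. real k * h (real k))
    = \<theta> * measure_pmf.expectation (gen_poisson_pmf \<mu> (\<theta> + \<mu>))
        (\<lambda>k. (\<theta> + \<mu> * (real k + 1)) * h (real (Suc k)))"
    unfolding P_def by (rule gen_poisson_size_bias_expectation[OF \<mu> \<theta> h])
  \<comment> \<open>Parameter \<open>\<theta> + \<mu>\<close> is the law of an independent sum with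
    parameters \<open>\<theta>\<close> and \<open>\<mu>\<close>; the extra 1 from
    \<open>Suc k\<close> joins the second summand to form \<open>B\<close>.\<close>
  also have "measure_pmf.expectation (gen_poisson_pmf \<mu> (\<theta> + \<mu>))
        (\<lambda>k. (\<theta> + \<mu> * (real k + 1)) * h (real (Suc k)))
    = measure_pmf.expectation (pair_pmf P Q) (\<lambda>z. (\<theta> + \<mu> * real (fst z)) * h (real (fst z)) * 1
        + R z + (\<theta> + \<mu> * real (fst z)) * h' (real (fst z)) * (real (snd z) + 1))"
    using gen_poisson_pmf_add[of \<mu> \<theta> \<mu>] \<mu> \<theta>
    by (simp add: P_def Q_def R_def algebra_simps)
  also have "\<dots> = measure_pmf.expectation P (\<lambda>k. (\<theta> + \<mu> * real k) * h (real k))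
      + measure_pmf.expectation (pair_pmf P Q) R
      + q * measure_pmf.expectation P (\<lambda>k. (\<theta> + \<mu> * real k) * h' (real k))"
    using pair_pmf_expectation_mult[OF i1, of Q "\<lambda>_. 1"] pair_pmf_expectation_mult[OF i2 iQ] iR EQ
    by simp
  \<comment> \<open>Recentring the random factor: its mean \<open>m\<close> produces the main term
    and its fluctuation \<open>\<mu> * (D - m)\<close> an error controlled by the standard
    deviation.\<close>
  also have "measure_pmf.expectation P (\<lambda>k. (\<theta> + \<mu> * real k) * h' (real k))
    = measure_pmf.expectation P (\<lambda>k. m * h' (real k) + \<mu> * ((real k - m) * h' (real k)))"
  proof -
    have "\<theta> + \<mu> * real k = m + \<mu> * (real k - m)" for k
      using m_fix by (simp add: algebra_simps)
    then have "(\<theta> + \<mu> * real k) * h' (real k) = m * h' (real k) + \<mu> * ((real k - m) * h' (real k))" for k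
      by (simp only: distrib_right mult.assoc)
    then show ?thesis by simp
  qed
  also have "\<dots> = m * measure_pmf.expectation P (\<lambda>k. h' (real k))
      + \<mu> * measure_pmf.expectation P (\<lambda>k. (real k - m) * h' (real k))"
    using i4 i5 by simp
  finally have main: "(\<theta> + \<mu>) * measure_pmf.expectation P (\<lambda>k. real k * h (real k))
    = \<theta> * (measure_pmf.expectation P (\<lambda>k. (\<theta> + \<mu> * real k) * h (real k))
      + measure_pmf.expectation (pair_pmf P Q) R
      + q * (m * measure_pmf.expectation P (\<lambda>k. h' (real k))
      + \<mu> * measure_pmf.expectation P (\<lambda>k. (real k - m) * h' (real k))))" .
  have left: "(1 - \<mu>) * measure_pmf.expectation P (\<lambda>k. (real k - m) * h (real k))
    = measure_pmf.expectation P (\<lambda>k. real k * h (real k))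
      - measure_pmf.expectation P (\<lambda>k. (\<theta> + \<mu> * real k) * h (real k))"
  proof -
    have "(1 - \<mu>) * ((real k - m) * h (real k)) = real k * h (real k) - (\<theta> + \<mu> * real k) * h (real k)" for k
    proof -
      have "(1 - \<mu>) * (real k - m) = real k - (\<theta> + \<mu> * real k)"
        using m_fix by (simp add: algebra_simps)
      then show ?thesis by (metis left_diff_distrib mult.assoc)
    qed
    then show ?thesis
      using i1 i3 by (simp flip: integral_mult_right_zero)
  qed
  have EP2: "measure_pmf.expectation P (\<lambda>k. \<bar>real k - m\<bar>) \<le> sqrt (\<theta> / (1 - \<mu>) ^ 3)"
  proof -
    have "measure_pmf.expectation P (\<lambda>k. \<bar>real k - m\<bar>)
      = measure_pmf.expectation P (\<lambda>k. \<bar>real k - m\<bar> * 1)" by simp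
    also have "\<dots> \<le> sqrt (measure_pmf.expectation P (\<lambda>k. (real k - m)\<^sup>2))"
    proof (rule real_le_rsqrt)
      have "integrable P (\<lambda>k. (real k)\<^sup>2)"
        unfolding P_def using \<mu> \<theta> by (intro integrable_gen_poisson_sq) auto
      then have i: "integrable P (\<lambda>k. (real k - m)\<^sup>2)"
        using iP by (simp add: power2_diff)
      have "(measure_pmf.expectation P (\<lambda>k. \<bar>real k - m\<bar>))\<^sup>2
          \<le> measure_pmf.expectation P (\<lambda>k. \<bar>real k - m\<bar>\<^sup>2)"
        using measure_pmf.variance_positive[of P "\<lambda>k. \<bar>real k - m\<bar>"] iP i
        by (subst (asm) measure_pmf.variance_eq) auto
      then show "(measure_pmf.expectation P (\<lambda>k. \<bar>real k - m\<bar> * 1))\<^sup>2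
          \<le> measure_pmf.expectation P (\<lambda>k. (real k - m)\<^sup>2)" by simp
    qed
    also have "\<dots> \<le> sqrt (\<theta> / (1 - \<mu>) ^ 3)"
      unfolding P_def m using \<mu> \<theta> by (intro real_sqrt_le_mono gen_poisson_variance_le) auto
    finally show ?thesis .
  qed
  have E4: "\<bar>measure_pmf.expectation P (\<lambda>k. (real k - m) * h' (real k))\<bar> \<le> B * sqrt (\<theta> / (1 - \<mu>) ^ 3)"
  proof -
    have "\<bar>measure_pmf.expectation P (\<lambda>k. (real k - m) * h' (real k))\<bar>
        \<le> measure_pmf.expectation P (\<lambda>k. \<bar>(real k - m) * h' (real k)\<bar>)"
      by (rule integral_abs_bound)
    also have "\<dots> \<le> measure_pmf.expectation P (\<lambda>k. B * \<bar>real k - m\<bar>)"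
    proof (rule integral_mono[OF integrable_abs[OF i4]])
      show "\<bar>(real k - m) * h' (real k)\<bar> \<le> B * \<bar>real k - m\<bar>" for k
        using mult_right_mono[OF h', of "\<bar>real k - m\<bar>" "real k"] by (simp add: abs_mult ac_simps)
    qed (use iP in simp)
    also have "\<dots> \<le> B * sqrt (\<theta> / (1 - \<mu>) ^ 3)"
      using EP2 B0 by (simp add: mult_left_mono)
    finally show ?thesis .
  qed
  have E3: "\<bar>measure_pmf.expectation P (\<lambda>k. real k * h (real k))\<bar> \<le> A * m"
  proof -
    have "\<bar>measure_pmf.expectation P (\<lambda>k. real k * h (real k))\<bar>
        \<le> measure_pmf.expectation P (\<lambda>k. \<bar>real k * h (real k)\<bar>)"
      by (rule integral_abs_bound)
    also have "\<dots> \<le> measure_pmf.expectation P (\<lambda>k. A * real k)"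
    proof (rule integral_mono[OF integrable_abs[OF i3]])
      show "\<bar>real k * h (real k)\<bar> \<le> A * real k" for k
        using mult_right_mono[OF h, of "real k" "real k"] by (simp add: abs_mult ac_simps)
    qed (use iP in simp)
    finally show ?thesis by (simp add: EP)
  qed
  define D where "D = measure_pmf.expectation P (\<lambda>k. (real k - m) * h (real k))
      - m / (1 - \<mu>)\<^sup>2 * measure_pmf.expectation P (\<lambda>k. h' (real k))"
  \<comment> \<open>Dividing \<open>main\<close> by \<open>\<theta>\<close> leaves the prefactor
    \<open>1 + \<mu> / \<theta>\<close>; its excess over 1 becomes the first error term. By
    \<open>E3\<close> and \<open>m = \<theta> * q\<close> that term is at most
    \<open>\<mu> * A * q\<close>, of the same size as the \<open>A\<close> part of
    \<open>R\<close>.\<close>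
  have "(1 - \<mu>) * D = - (\<mu> / \<theta>) * measure_pmf.expectation P (\<lambda>k. real k * h (real k))
      + measure_pmf.expectation (pair_pmf P Q) R
      + q * \<mu> * measure_pmf.expectation P (\<lambda>k. (real k - m) * h' (real k))"
  proof -
    have e: "(1 - \<mu>) * (m / (1 - \<mu>)\<^sup>2) = q * m"
      using \<mu> by (simp add: q_def power2_eq_square)
    have "measure_pmf.expectation P (\<lambda>k. real k * h (real k))
        + \<mu> / \<theta> * measure_pmf.expectation P (\<lambda>k. real k * h (real k))
      = measure_pmf.expectation P (\<lambda>k. (\<theta> + \<mu> * real k) * h (real k))
      + measure_pmf.expectation (pair_pmf P Q) R
      + q * (m * measure_pmf.expectation P (\<lambda>k. h' (real k))
      + \<mu> * measure_pmf.expectation P (\<lambda>k. (real k - m) * h' (real k)))"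
    proof -
      have "x + \<mu> / \<theta> * x = y" if "(\<theta> + \<mu>) * x = \<theta> * y" for x y
        using that \<theta> by (simp add: field_simps)
      from this[OF main] show ?thesis .
    qed
    moreover have "(1 - \<mu>) * D = (1 - \<mu>) * measure_pmf.expectation P (\<lambda>k. (real k - m) * h (real k))
        - q * m * measure_pmf.expectation P (\<lambda>k. h' (real k))"
      unfolding D_def right_diff_distrib mult.assoc[symmetric] e ..
    ultimately show ?thesis
      unfolding left by (simp add: algebra_simps)
  qed
  then have "\<bar>(1 - \<mu>) * D\<bar> \<le> \<bar>- (\<mu> / \<theta>) * measure_pmf.expectation P (\<lambda>k. real k * h (real k))\<bar>
      + \<bar>measure_pmf.expectation (pair_pmf P Q) R\<bar>
      + \<bar>q * \<mu> * measure_pmf.expectation P (\<lambda>k. (real k - m) * h' (real k))\<bar>"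
    by linarith
  also have "\<dots> \<le> \<mu> / \<theta> * (A * m) + (\<mu> * A * q + C * (m * q ^ 3)) + q * \<mu> * (B * sqrt (\<theta> / (1 - \<mu>) ^ 3))"
  proof (intro add_mono ER)
    show "\<bar>- (\<mu> / \<theta>) * measure_pmf.expectation P (\<lambda>k. real k * h (real k))\<bar> \<le> \<mu> / \<theta> * (A * m)"
      using E3 \<mu> \<theta> by (simp add: abs_mult divide_right_mono mult_left_mono)
    show "\<bar>q * \<mu> * measure_pmf.expectation P (\<lambda>k. (real k - m) * h' (real k))\<bar>
        \<le> q * \<mu> * (B * sqrt (\<theta> / (1 - \<mu>) ^ 3))"
      using E4 \<mu> q by (simp only: abs_mult) (simp add: mult_left_mono)
  qed
  also have "\<dots> = 2 * \<mu> * A / (1 - \<mu>) + C * m / (1 - \<mu>) ^ 3 + \<mu> / (1 - \<mu>) * B * sqrt (\<theta> / (1 - \<mu>) ^ 3)"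
    using \<theta> by (simp add: mq) (simp add: q_def power_divide mult_ac)
  finally show ?thesis
    using \<mu> by (simp add: abs_mult D_def P_def)
qed

section \<open>Stein's method for the generalized Poisson distribution\<close>

text \<open>The difference \<open>G - q\<close> is nonincreasing with limit 0, hence nonnegative.
  This compares tail integrals through derivatives and limits alone.\<close>

lemma DERIV_le_imp_le_limits:
  fixes q G :: "real \<Rightarrow> real"
  assumes q: "\<And>t. x \<le> t \<Longrightarrow> (q has_real_derivative q' t) (at t)"
    and G: "\<And>t. x \<le> t \<Longrightarrow> (G has_real_derivative G' t) (at t)"
    and le: "\<And>t. x \<le> t \<Longrightarrow> - q' t \<le> - G' t"
    and lim: "(q \<longlongrightarrow> 0) at_top" "(G \<longlongrightarrow> 0) at_top"
  shows "q x \<le> G x"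
proof -
  have mono: "G t - q t \<le> G x - q x" if "x \<le> t" for t
  proof (rule DERIV_nonpos_imp_nonincreasing[OF that])
    fix s assume "x \<le> s"
    then show "\<exists>y. ((\<lambda>t. G t - q t) has_real_derivative y) (at s) \<and> y \<le> 0"
      using q G le by (intro exI[of _ "G' s - q' s"]) (auto intro!: derivative_eq_intros)
  qed
  have "((\<lambda>t. G t - q t) \<longlongrightarrow> 0 - 0) at_top"
    by (intro tendsto_intros lim)
  then have "0 - 0 \<le> G x - q x"
    by (rule tendsto_upperbound) (auto intro: eventually_mono[OF eventually_ge_at_top[of x]] mono)
  then show ?thesis by simp
qed

text \<open>The function \<open>q\<close> acts as a tail integral of its derivative. The part
  \<open>A * t\<close> integrates exactly to \<open>A * exp (- x\<^sup>2 / 2)\<close>; the constant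
  part is covered by the crude Mills ratio bound \<open>2 / (1 + x)\<close>.\<close>

lemma gaussian_tail_compare_pos:
  fixes q q' :: "real \<Rightarrow> real"
  assumes q: "\<And>t. (q has_real_derivative q' t) (at t)"
    and bound: "\<And>t. \<bar>q' t\<bar> \<le> (A * \<bar>t\<bar> + K) * exp (- t\<^sup>2 / 2)"
    and lim: "(q \<longlongrightarrow> 0) at_top"
    and x: "0 \<le> x" and K: "0 \<le> K"
  shows "\<bar>q x\<bar> \<le> (A + 2 * K / (1 + \<bar>x\<bar>)) * exp (- x\<^sup>2 / 2)"
proof -
  \<comment> \<open>An explicit majorant with \<open>- G' \<ge> (A * t + K) * exp (- t\<^sup>2 / 2)\<close> on \<open>t \<ge> 0\<close>.\<close>
  define G where "G t = (A + 2 * K / (1 + t)) * exp (- t\<^sup>2 / 2)" for t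
  define G' where "G' t = - (A * t + K * (2 / (1 + t)\<^sup>2 + 2 * t / (1 + t))) * exp (- t\<^sup>2 / 2)" for t
  have G: "(G has_real_derivative G' t) (at t)" if "x \<le> t" for t
  proof -
    have "1 + t \<noteq> 0" using that x by simp
    then have "(G has_real_derivative - (2 * K) / (1 + t)\<^sup>2 * exp (- t\<^sup>2 / 2)
        + (A + 2 * K / (1 + t)) * (exp (- t\<^sup>2 / 2) * (- t))) (at t)"
      unfolding G_def by (auto intro!: derivative_eq_intros simp: power2_eq_square)
    also have "- (2 * K) / (1 + t)\<^sup>2 * exp (- t\<^sup>2 / 2)
        + (A + 2 * K / (1 + t)) * (exp (- t\<^sup>2 / 2) * (- t)) = G' t"
      unfolding G'_def by (simp add: algebra_simps)
    finally show ?thesis .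
  qed
  have G_le: "\<bar>q' t\<bar> \<le> - G' t" if "x \<le> t" for t
  proof -
    have t: "0 \<le> t" using that x by simp
    have "1 \<le> 2 / (1 + t)\<^sup>2 + 2 * t / (1 + t)"
    proof -
      have "2 / (1 + t)\<^sup>2 + 2 * t / (1 + t) = (2 + 2 * t * (1 + t)) / (1 + t)\<^sup>2"
        using t by (simp add: power2_eq_square divide_simps) (simp add: algebra_simps)
      moreover have "(1 + t)\<^sup>2 \<le> 2 + 2 * t * (1 + t)"
        by (simp add: power2_eq_square algebra_simps)
      ultimately show ?thesis using t by (simp add: le_divide_eq)
    qed
    then have "A * t + K * 1 \<le> A * t + K * (2 / (1 + t)\<^sup>2 + 2 * t / (1 + t))"
      using K by (intro add_left_mono mult_left_mono)
    then have "(A * t + K) * exp (- t\<^sup>2 / 2)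
        \<le> (A * t + K * (2 / (1 + t)\<^sup>2 + 2 * t / (1 + t))) * exp (- t\<^sup>2 / 2)"
      by (intro mult_right_mono) simp_all
    then have "(A * \<bar>t\<bar> + K) * exp (- t\<^sup>2 / 2) \<le> - G' t"
      unfolding G'_def using t by (simp only: abs_of_nonneg minus_mult_left minus_minus)
    with bound show ?thesis by (rule order_trans)
  qed
  have limG: "(G \<longlongrightarrow> 0) at_top"
    unfolding G_def by real_asymp
  have "q x \<le> G x"
    by (rule DERIV_le_imp_le_limits[OF q G _ lim limG]) (use G_le in \<open>force simp: abs_le_iff\<close>)+
  moreover have "- q x \<le> G x"
    using lim by (intro DERIV_le_imp_le_limits[of x "\<lambda>t. - q t" "\<lambda>t. - q' t" G G'] limG G)
      (use q G_le in \<open>force intro!: derivative_eq_intros tendsto_eq_intros simp: abs_le_iff\<close>)+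
  ultimately show ?thesis
    using x by (simp add: G_def abs_le_iff)
qed

text \<open>Negative \<open>x\<close> are reflected, so each point is estimated from the infinity on
  its own side; hence the two limits. The decay \<open>1 / (1 + \<bar>x\<bar>)\<close> later
  compensates a factor \<open>x\<close>.\<close>

lemma gaussian_tail_compare:
  fixes q q' :: "real \<Rightarrow> real"
  assumes q: "\<And>t. (q has_real_derivative q' t) (at t)"
    and bound: "\<And>t. \<bar>q' t\<bar> \<le> (A * \<bar>t\<bar> + K) * exp (- t\<^sup>2 / 2)"
    and lim: "(q \<longlongrightarrow> 0) at_top" "(q \<longlongrightarrow> 0) at_bot" and K: "0 \<le> K"
  shows "\<bar>q x\<bar> \<le> (A + 2 * K / (1 + \<bar>x\<bar>)) * exp (- x\<^sup>2 / 2)"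
proof (cases "0 \<le> x")
  case True
  then show ?thesis by (intro gaussian_tail_compare_pos[OF q bound lim(1) _ K])
next
  case False
  have "\<bar>q (- (- x))\<bar> \<le> (A + 2 * K / (1 + \<bar>- x\<bar>)) * exp (- (- x)\<^sup>2 / 2)"
  proof (rule gaussian_tail_compare_pos[of "\<lambda>t. q (- t)" "\<lambda>t. - q' (- t)"])
    show "((\<lambda>t. q (- t)) has_real_derivative - q' (- t)) (at t)" for t
      by (rule DERIV_mirror[THEN iffD1, OF q])
    show "\<bar>- q' (- t)\<bar> \<le> (A * \<bar>t\<bar> + K) * exp (- t\<^sup>2 / 2)" for t
      using bound[of "- t"] by simp
    show "((\<lambda>t. q (- t)) \<longlongrightarrow> 0) at_top"
      using lim(2) unfolding filterlim_at_bot_mirror .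
  qed (use False K in auto)
  then show ?thesis by simp
qed

section \<open>Stein's equation for the standard normal law\<close>

abbreviation std_normal_expectation :: "(real \<Rightarrow> real) \<Rightarrow> real" where
  "std_normal_expectation u \<equiv> (\<integral>x. std_normal_density x * u x \<partial>lborel)"

lemma integrable_std_normal_linear_growth:
  assumes [measurable]: "u \<in> borel_measurable borel" and "\<And>x. \<bar>u x\<bar> \<le> a + b * \<bar>x\<bar>"
  shows "integrable lborel (\<lambda>x. std_normal_density x * u x)"
proof (rule Bochner_Integration.integrable_bound)
  show "integrable lborel (\<lambda>x. a * (std_normal_density x * \<bar>x\<bar> ^ 0) + b * (std_normal_density x * \<bar>x\<bar> ^ 1))"
    by (intro Bochner_Integration.integrable_add integrable_mult_right integrable_std_normal_moment_abs)
  have "\<bar>std_normal_density x * u x\<bar>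
      \<le> a * (std_normal_density x * \<bar>x\<bar> ^ 0) + b * (std_normal_density x * \<bar>x\<bar> ^ 1)" for x
    using mult_left_mono[OF assms(2), of "std_normal_density x" x]
    by (simp add: abs_mult algebra_simps)
  then show "AE x in lborel. norm (std_normal_density x * u x) \<le> norm (a *
      (std_normal_density x * \<bar>x\<bar> ^ 0) + b * (std_normal_density x * \<bar>x\<bar> ^ 1))"
    by (intro AE_I2) (simp add: order_trans[OF _ abs_ge_self])
qed simp

lemma lipschitz_linear_growth:
  fixes u :: "real \<Rightarrow> real"
  assumes "\<And>x y. \<bar>u x - u y\<bar> \<le> \<bar>x - y\<bar>"
  shows "\<bar>u x\<bar> \<le> \<bar>u 0\<bar> + 1 * \<bar>x\<bar>"
  using assms[of x 0] by linarith

text \<open>Average \<open>\<bar>u x - u z\<bar> \<le> \<bar>x\<bar> + \<bar>z\<bar>\<close> over a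
  standard normal \<open>z\<close>, whose absolute mean \<open>sqrt (2 / pi)\<close> is below
  1.\<close>

lemma lipschitz_deviation_std_normal:
  fixes u :: "real \<Rightarrow> real"
  assumes lip: "\<And>x y. \<bar>u x - u y\<bar> \<le> \<bar>x - y\<bar>" and [measurable]: "u \<in> borel_measurable borel"
  shows "\<bar>u x - std_normal_expectation u\<bar> \<le> \<bar>x\<bar> + 1"
proof -
  have iu: "integrable lborel (\<lambda>z. std_normal_density z * u z)"
    by (rule integrable_std_normal_linear_growth[OF _ lipschitz_linear_growth[OF lip]]) simp
  have one: "integrable lborel (\<lambda>z. std_normal_density z * c)" "std_normal_expectation (\<lambda>_. c) = c" for c
    using integrable_std_normal_moment[of 0] integral_std_normal_moment_even[of 0] by auto
  have two: "integrable lborel (\<lambda>z. std_normal_density z * \<bar>z\<bar>)"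
    using integrable_std_normal_moment_abs[of 1] by simp
  have abs_le: "std_normal_expectation (\<lambda>z. \<bar>z\<bar>) \<le> 1"
  proof -
    have "std_normal_expectation (\<lambda>z. \<bar>z\<bar>) = sqrt (2 / pi)"
      using integral_std_normal_moment_abs_odd[of 0] by simp
    also have "\<dots> \<le> sqrt 1" using pi_gt3 by (intro real_sqrt_le_mono) simp
    finally show ?thesis by simp
  qed
  have "u x - std_normal_expectation u = std_normal_expectation (\<lambda>_. u x) - std_normal_expectation u"
    by (simp only: one)
  also have "\<dots> = (\<integral>z. std_normal_density z * u x - std_normal_density z * u z \<partial>lborel)"
    by (rule Bochner_Integration.integral_diff[symmetric, OF one(1) iu])
  finally have "\<bar>u x - std_normal_expectation u\<bar>
      \<le> (\<integral>z. \<bar>std_normal_density z * u x - std_normal_density z * u z\<bar> \<partial>lborel)"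
    using integral_abs_bound by metis
  also have "\<dots> \<le> (\<integral>z. std_normal_density z * \<bar>x\<bar> + std_normal_density z * \<bar>z\<bar> \<partial>lborel)"
  proof (rule integral_mono)
    fix z
    have "\<bar>std_normal_density z * u x - std_normal_density z * u z\<bar> = std_normal_density z * \<bar>u x - u z\<bar>"
      by (simp add: abs_mult right_diff_distrib[symmetric])
    also have "\<dots> \<le> std_normal_density z * (\<bar>x\<bar> + \<bar>z\<bar>)"
      using lip[of x z] by (intro mult_left_mono) auto
    finally show "\<bar>std_normal_density z * u x - std_normal_density z * u z\<bar>
        \<le> std_normal_density z * \<bar>x\<bar> + std_normal_density z * \<bar>z\<bar>"
      by (simp add: distrib_left)
  qed (use one iu two in auto)
  also have "\<dots> = \<bar>x\<bar> + std_normal_expectation (\<lambda>z. \<bar>z\<bar>)"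
    using Bochner_Integration.integral_add[OF one(1)[of "\<bar>x\<bar>"] two] one(2)[of "\<bar>x\<bar>"] by simp
  finally show ?thesis using abs_le by simp
qed

lemma lower_integral_real:
  fixes g :: "real \<Rightarrow> real"
  assumes g: "integrable lborel g" and cont: "continuous_on UNIV g"
  defines "q \<equiv> \<lambda>x. \<integral>t. indicator {..x} t * g t \<partial>lborel"
  shows lower_integral_deriv: "(q has_real_derivative g x) (at x)"
    and lower_integral_at_top: "(q \<longlongrightarrow> integral\<^sup>L lborel g) at_top"
    and lower_integral_at_bot: "(q \<longlongrightarrow> 0) at_bot"
proof -
  have [measurable]: "g \<in> borel_measurable borel"
    by (rule borel_measurable_continuous_onI[OF cont])
  have ig: "integrable lborel (\<lambda>t. indicator A t * g t)" if [measurable]: "A \<in> sets borel" for A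
    using integrable_mult_indicator[OF _ g, of A] that by simp
  show top: "(q \<longlongrightarrow> integral\<^sup>L lborel g) at_top"
    unfolding q_def using tendsto_integral_at_top[OF sets_lborel g] by simp
  have diff: "q y = q a + integral {a..y} g" if "a \<le> y" for a y
  proof -
    have "q y = (\<integral>t. indicator {..a} t * g t + indicator {a<..y} t * g t \<partial>lborel)"
      unfolding q_def using that
      by (intro Bochner_Integration.integral_cong) (auto simp: indicator_def)
    also have "\<dots> = q a + (\<integral>t. indicator {a<..y} t * g t \<partial>lborel)"
      unfolding q_def by (intro Bochner_Integration.integral_add ig) auto
    also have "(\<integral>t. indicator {a<..y} t * g t \<partial>lborel) = (LINT t:{a..y}|lborel. g t)"
      unfolding set_lebesgue_integral_def
    proof (rule integral_cong_AE)
      show "AE t in lborel. indicator {a<..y} t * g t = indicator {a..y} t *\<^sub>R g t"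
        using AE_lborel_singleton[of a] by eventually_elim (auto simp: indicator_def)
    qed measurable
    also have "\<dots> = integral {a..y} g"
      using ig[of "{a..y}"] by (intro set_borel_integral_eq_integral) (simp add: set_integrable_def)
    finally show ?thesis .
  qed
  show "(q has_real_derivative g x) (at x)"
  proof -
    have "((\<lambda>y. integral {x - 1..y} g) has_real_derivative g x) (at x within {x - 1..x + 1})"
      by (rule integral_has_real_derivative) (auto intro: continuous_on_subset[OF cont])
    moreover have "at x within {x - 1..x + 1} = at x"
      by (rule at_within_interior) simp
    ultimately have "((\<lambda>y. integral {x - 1..y} g) has_real_derivative g x) (at x)"
      by metis
    from DERIV_add[OF DERIV_const this]
    have "((\<lambda>y. q (x - 1) + integral {x - 1..y} g) has_real_derivative g x) (at x)"
      by simp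
    then show ?thesis
    proof (rule has_field_derivative_transform_within_open[of _ _ _ "{x - 1<..<x + 1}"])
      show "q (x - 1) + integral {x - 1..y} g = q y" if "y \<in> {x - 1<..<x + 1}" for y
        using diff[of "x - 1" y] that by simp
    qed auto
  qed
  \<comment> \<open>The limit at minus infinity follows from the one at plus infinity, applied to
    the reflected integrand.\<close>
  have "((\<lambda>x. integral\<^sup>L lborel g - (\<integral>t. indicator {..x} t * g (- t) \<partial>lborel)) \<longlongrightarrow> integral\<^sup>L lborel g - integral\<^sup>L lborel (\<lambda>t. g (- t))) at_top"
    using tendsto_integral_at_top[OF sets_lborel, of "\<lambda>t. g (- t)"] lborel_integrable_real_affine[OF g, of "-1" 0]
    by (intro tendsto_intros) simp
  moreover have "integral\<^sup>L lborel (\<lambda>t. g (- t)) = integral\<^sup>L lborel g"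
    using lborel_integral_real_affine[of "-1" g 0] by simp
  moreover have "q (- x) = integral\<^sup>L lborel g - (\<integral>t. indicator {..x} t * g (- t) \<partial>lborel)" for x
  proof -
    have "(\<integral>t. indicator {..x} t * g (- t) \<partial>lborel) = (\<integral>t. indicator {..x} (- t) * g t \<partial>lborel)"
      using lborel_integral_real_affine[of "-1" "\<lambda>t. indicator {..x} (- t) * g t" 0] by simp
    also have "\<dots> = (\<integral>t. g t - indicator {..- x} t * g t \<partial>lborel)"
    proof (rule integral_cong_AE)
      show "AE t in lborel. indicator {..x} (- t) * g t = g t - indicator {..- x} t * g t"
        using AE_lborel_singleton[of "- x"] by eventually_elim (auto simp: indicator_def)
    qed measurable
    also have "\<dots> = integral\<^sup>L lborel g - q (- x)"
      unfolding q_def by (intro Bochner_Integration.integral_diff g ig) simp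
    finally show ?thesis by simp
  qed
  ultimately show "(q \<longlongrightarrow> 0) at_bot"
    unfolding filterlim_at_bot_mirror by simp
qed

text \<open>The classical solution is \<open>exp (x\<^sup>2 / 2)\<close> times the Gaussian-weighted
  integral of \<open>u - E u\<close> up to \<open>x\<close>. Tail comparison is applied twice. With
  \<open>A = K = 1\<close> it bounds \<open>f\<close> by
  \<open>1 + 2 / (1 + \<bar>x\<bar>) \<le> 3\<close>; with \<open>A = 0\<close> and
  \<open>K = 3 + 1\<close> it gives \<open>\<bar>f' x\<bar> \<le> 8 / (1 + \<bar>x\<bar>)\<close>.
  The constant 12 is \<open>3 + 8 + 1\<close>, from the three terms of the second
  derivative.\<close>

lemma stein_solution:
  fixes u u' :: "real \<Rightarrow> real"
  assumes du: "\<And>x. (u has_real_derivative u' x) (at x)" and u': "\<And>x. \<bar>u' x\<bar> \<le> 1"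
  obtains f f' where "\<And>x. (f has_real_derivative f' x) (at x)"
    and "\<And>x. f' x - x * f x = u x - std_normal_expectation u"
    and "\<And>x. \<bar>f x\<bar> \<le> 3" and "\<And>x. \<bar>f' x\<bar> \<le> 8" and "\<And>x y. \<bar>f' x - f' y\<bar> \<le> 12 * \<bar>x - y\<bar>"
proof -
  have lip: "\<bar>u x - u y\<bar> \<le> \<bar>x - y\<bar>" for x y
    using field_differentiable_bound[of UNIV u u' 1 x y] du u' by simp
  have cont: "continuous_on UNIV u"
    using du by (intro continuous_at_imp_continuous_on) (auto intro: DERIV_isCont)
  have [measurable]: "u \<in> borel_measurable borel"
    by (rule borel_measurable_continuous_onI[OF cont])
  define v where "v x = u x - std_normal_expectation u" for x
  define c where "c = sqrt (2 * pi)"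
  have c: "0 < c" by (simp add: c_def)
  have v: "\<bar>v x\<bar> \<le> 1 * \<bar>x\<bar> + 1" for x
    using lipschitz_deviation_std_normal[OF lip, of x] by (simp add: v_def)
  define g where "g x = std_normal_density x * v x" for x
  have g_eq: "c * g x = v x * exp (- x\<^sup>2 / 2)" for x
    using c by (simp add: g_def c_def std_normal_density_def)
  have [measurable]: "v \<in> borel_measurable borel" unfolding v_def by measurable
  have ig: "integrable lborel g"
    unfolding g_def by (rule integrable_std_normal_linear_growth[of v 1 1]) (use v in \<open>auto simp: add.commute\<close>)
  have iu: "integrable lborel (\<lambda>z. std_normal_density z * u z)"
    by (rule integrable_std_normal_linear_growth[OF _ lipschitz_linear_growth[OF lip]]) simp
  \<comment> \<open>Centring makes the integral vanish at plus infinity as well; otherwise the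
    solution would grow like \<open>exp (x\<^sup>2 / 2)\<close> there.\<close>
  have Eg: "integral\<^sup>L lborel g = 0"
  proof -
    have "integral\<^sup>L lborel g
        = (\<integral>x. std_normal_density x * u x - std_normal_density x * std_normal_expectation u \<partial>lborel)"
      by (simp add: g_def[abs_def] v_def right_diff_distrib)
    also have "\<dots> = std_normal_expectation u - std_normal_expectation (\<lambda>_. std_normal_expectation u)"
      by (rule Bochner_Integration.integral_diff[OF iu]) (use integrable_std_normal_moment[of 0] in simp)
    also have "\<dots> = 0" using integral_std_normal_moment_even[of 0] by simp
    finally show ?thesis .
  qed
  have cont_g: "continuous_on UNIV g"
    unfolding g_def v_def std_normal_density_def by (intro continuous_intros cont) auto
  \<comment> \<open>The factor \<open>c\<close> cancels the normalization of the density, so that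
    the derivative is \<open>v x * exp (- x\<^sup>2 / 2)\<close>.\<close>
  define Q where "Q x = c * (\<integral>t. indicator {..x} t * g t \<partial>lborel)" for x
  have dQ: "(Q has_real_derivative v x * exp (- x\<^sup>2 / 2)) (at x)" for x
    unfolding Q_def g_eq[symmetric] by (intro DERIV_cmult lower_integral_deriv ig cont_g)
  have "\<bar>Q x\<bar> \<le> (1 + 2 * 1 / (1 + \<bar>x\<bar>)) * exp (- x\<^sup>2 / 2)" for x
  proof (rule gaussian_tail_compare[OF dQ])
    show "\<bar>v t * exp (- t\<^sup>2 / 2)\<bar> \<le> (1 * \<bar>t\<bar> + 1) * exp (- t\<^sup>2 / 2)" for t
      using v[of t] by (simp add: abs_mult)
    show "(Q \<longlongrightarrow> 0) at_top"
      using tendsto_mult[OF tendsto_const lower_integral_at_top[OF ig cont_g], of c]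
      by (simp add: Q_def[abs_def] Eg)
    show "(Q \<longlongrightarrow> 0) at_bot"
      using tendsto_mult[OF tendsto_const lower_integral_at_bot[OF ig cont_g], of c]
      by (simp add: Q_def[abs_def])
  qed simp
  moreover have "(1 + 2 * 1 / (1 + \<bar>x\<bar>)) * exp (- x\<^sup>2 / 2) \<le> 3 * exp (- x\<^sup>2 / 2)" for x :: real
    by (intro mult_right_mono) (auto simp: divide_le_eq)
  ultimately have Q: "\<bar>Q x\<bar> \<le> 3 * exp (- x\<^sup>2 / 2)" for x by (meson order_trans)
  have exp_inv: "exp (- x\<^sup>2 / 2) * exp (x\<^sup>2 / 2) = 1" for x :: real
    by (simp add: exp_add[symmetric])
  define f where "f x = Q x * exp (x\<^sup>2 / 2)" for x
  define f' where "f' x = x * f x + v x" for x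
  \<comment> \<open>Differentiating Stein's equation gives \<open>f'' - x * f' = f + u'\<close>, again a first-order equation, now
    for \<open>f'\<close> and with a bounded right-hand side.\<close>
  define f'' where "f'' x = f x + x * f' x + u' x" for x
  have f: "\<bar>f x\<bar> \<le> 3" for x
  proof -
    have "\<bar>f x\<bar> \<le> 3 * exp (- x\<^sup>2 / 2) * exp (x\<^sup>2 / 2)"
      unfolding f_def abs_mult using Q[of x] by (simp add: mult_right_mono)
    then show ?thesis by (simp only: mult.assoc exp_inv)
  qed
  have df: "(f has_real_derivative f' x) (at x)" for x
  proof -
    have "(f has_real_derivative v x * exp (- x\<^sup>2 / 2) * exp (x\<^sup>2 / 2) + exp (x\<^sup>2 / 2) * x * Q x) (at x)"
      unfolding f_def by (auto intro!: derivative_eq_intros dQ)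
    then show ?thesis
      by (simp only: mult.assoc exp_inv) (simp add: f'_def f_def mult_ac add_ac)
  qed
  have df': "(f' has_real_derivative f'' x) (at x)" for x
    unfolding f'_def[abs_def] v_def f''_def by (auto intro!: derivative_eq_intros df du simp: f'_def v_def)
  define q where "q x = f' x * exp (- x\<^sup>2 / 2)" for x
  \<comment> \<open>Stein's equation alone bounds \<open>f'\<close> only linearly. This serves to
    make \<open>q\<close> vanish at both infinities; the comparison then upgrades it to a decaying
    bound.\<close>
  have q_le: "\<bar>q x\<bar> \<le> (4 * \<bar>x\<bar> + 1) * exp (- x\<^sup>2 / 2)" for x
  proof -
    have "\<bar>f' x\<bar> \<le> \<bar>x\<bar> * \<bar>f x\<bar> + \<bar>v x\<bar>"
      unfolding f'_def by (simp add: abs_mult[symmetric])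
    also have "\<dots> \<le> \<bar>x\<bar> * 3 + (1 * \<bar>x\<bar> + 1)"
      by (intro add_mono mult_left_mono f v) simp
    finally show ?thesis by (simp add: q_def abs_mult)
  qed
  have "\<bar>q x\<bar> \<le> (0 + 2 * 4 / (1 + \<bar>x\<bar>)) * exp (- x\<^sup>2 / 2)" for x
  proof (rule gaussian_tail_compare)
    show "(q has_real_derivative (f t + u' t) * exp (- t\<^sup>2 / 2)) (at t)" for t
      unfolding q_def by (auto intro!: derivative_eq_intros df' simp: f''_def algebra_simps)
    show "\<bar>(f t + u' t) * exp (- t\<^sup>2 / 2)\<bar> \<le> (0 * \<bar>t\<bar> + 4) * exp (- t\<^sup>2 / 2)" for t
    proof -
      have "\<bar>f t + u' t\<bar> \<le> 4" using f[of t] u'[of t] by linarith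
      then show ?thesis by (simp add: abs_mult)
    qed
    have "((\<lambda>x::real. (4 * \<bar>x\<bar> + 1) * exp (- x\<^sup>2 / 2)) \<longlongrightarrow> 0) at_top"
      by real_asymp
    then show "(q \<longlongrightarrow> 0) at_top"
      by (rule Lim_null_comparison[rotated]) (use q_le in auto)
    have "((\<lambda>x::real. (4 * \<bar>x\<bar> + 1) * exp (- x\<^sup>2 / 2)) \<longlongrightarrow> 0) at_bot"
      by real_asymp
    then show "(q \<longlongrightarrow> 0) at_bot"
      by (rule Lim_null_comparison[rotated]) (use q_le in auto)
  qed simp
  then have "\<bar>f' x\<bar> * exp (- x\<^sup>2 / 2) \<le> 8 / (1 + \<bar>x\<bar>) * exp (- x\<^sup>2 / 2)" for x
    by (simp add: q_def abs_mult)
  then have f'_le: "\<bar>f' x\<bar> \<le> 8 / (1 + \<bar>x\<bar>)" for x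
    by (rule mult_right_le_imp_le) simp
  have f': "\<bar>f' x\<bar> \<le> 8" for x
    using f'_le[of x] by (rule order_trans) (simp add: divide_le_eq)
  have f'': "\<bar>f'' x\<bar> \<le> 12" for x
  proof -
    have "\<bar>x * f' x\<bar> \<le> \<bar>x\<bar> * (8 / (1 + \<bar>x\<bar>))"
      unfolding abs_mult by (intro mult_left_mono f'_le) simp
    also have "\<dots> \<le> 8" by (simp add: divide_le_eq)
    finally show ?thesis unfolding f''_def using f[of x] u'[of x] by linarith
  qed
  show thesis
  proof (rule that[of f f'])
    show "f' x - x * f x = u x - std_normal_expectation u" for x
      by (simp add: f'_def v_def)
    show "\<bar>f' x - f' y\<bar> \<le> 12 * \<bar>x - y\<bar>" for x y
      using field_differentiable_bound[of UNIV f' f'' 12 x y] df' f'' by simp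
  qed (fact df f f')+
qed

text \<open>The approximation is the average of \<open>u\<close> over the window from
  \<open>x\<close> to \<open>x + \<epsilon>\<close>. Its derivative is a difference quotient of
  \<open>u\<close>, hence at most 1 in absolute value, and by the mean value theorem the average is
  a value of \<open>u\<close> within the window.\<close>

lemma lipschitz_smooth_approx:
  fixes u :: "real \<Rightarrow> real"
  assumes lip: "\<And>x y. \<bar>u x - u y\<bar> \<le> \<bar>x - y\<bar>" and "0 < \<epsilon>"
  obtains v v' where "\<And>x. (v has_real_derivative v' x) (at x)" and "\<And>x. \<bar>v' x\<bar> \<le> 1"
    and "\<And>x. \<bar>v x - u x\<bar> \<le> \<epsilon>"
proof -
  have "1-lipschitz_on UNIV u"
    using lip by (intro lipschitz_onI) (auto simp: dist_real_def)
  then have cont: "isCont u x" for x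
    using lipschitz_on_continuous_on continuous_on_eq_continuous_at by blast
  obtain U where "\<forall>x::real. -\<infinity> < ereal x \<longrightarrow> ereal x < \<infinity> \<longrightarrow> (U has_vector_derivative u x) (at x)"
    using einterval_antiderivative[of "-\<infinity>" "\<infinity>" u] cont by auto
  then have U: "(U has_real_derivative u x) (at x)" for x
    by (simp add: has_real_derivative_iff_has_vector_derivative)
  show thesis
  proof (rule that[of "\<lambda>x. (U (x + \<epsilon>) - U x) / \<epsilon>" "\<lambda>x. (u (x + \<epsilon>) - u x) / \<epsilon>"])
    fix x
    have "((\<lambda>x. U (x + \<epsilon>)) has_real_derivative u (x + \<epsilon>)) (at x)"
      using U[of "x + \<epsilon>"] by (simp add: DERIV_shift)
    then show "((\<lambda>x. (U (x + \<epsilon>) - U x) / \<epsilon>) has_real_derivative (u (x + \<epsilon>) - u x) / \<epsilon>) (at x)"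
      by (intro DERIV_cdivide DERIV_diff U)
    show "\<bar>(u (x + \<epsilon>) - u x) / \<epsilon>\<bar> \<le> 1"
      using lip[of "x + \<epsilon>" x] \<open>0 < \<epsilon>\<close> by (simp add: divide_le_eq)
    obtain \<xi> where "x < \<xi>" "\<xi> < x + \<epsilon>" "U (x + \<epsilon>) - U x = (x + \<epsilon> - x) * u \<xi>"
      using MVT2[of x "x + \<epsilon>" U u] U \<open>0 < \<epsilon>\<close> by auto
    then show "\<bar>(U (x + \<epsilon>) - U x) / \<epsilon> - u x\<bar> \<le> \<epsilon>"
      using lip[of \<xi> x] \<open>0 < \<epsilon>\<close> by simp
  qed
qed

section \<open>Normal approximation of the generalized Poisson law\<close>

lemma integrable_pmf_lipschitz:
  fixes p :: "nat pmf" and u :: "real \<Rightarrow> real"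
  assumes lip: "\<And>x y. \<bar>u x - u y\<bar> \<le> \<bar>x - y\<bar>" and p: "integrable p real"
  shows "integrable p (\<lambda>k. u ((real k - m) / s))"
proof (rule Bochner_Integration.integrable_bound[of _ "\<lambda>k. \<bar>u 0\<bar> + \<bar>(real k - m) / s\<bar>"])
  show "integrable p (\<lambda>k. \<bar>u 0\<bar> + \<bar>(real k - m) / s\<bar>)"
    using p by simp
  have "\<bar>u x\<bar> \<le> \<bar>u 0\<bar> + \<bar>x\<bar>" for x
    using lipschitz_linear_growth[OF lip, of x] by simp
  then show "AE k in p. norm (u ((real k - m) / s)) \<le> norm (\<bar>u 0\<bar> + \<bar>(real k - m) / s\<bar>)"
    unfolding real_norm_def by (intro AE_pmfI order_trans[OF _ abs_ge_self])
qed simp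

text \<open>The Stein identity is used with \<open>h x = f ((x - m) / \<sigma>)\<close>, so its
  constants are 3, \<open>8 / \<sigma>\<close> and \<open>12 / \<sigma>\<^sup>2\<close>. Because
  \<open>m / (1 - \<mu>)\<^sup>2 = \<sigma>\<^sup>2\<close>, its left side is
  \<open>(1 - \<mu>) * \<sigma>\<close> times the wanted difference. The errors are
  \<open>6 * \<mu>\<close>, 12 and \<open>8 * \<mu>\<close>, each over \<open>1 - \<mu>\<close>;
  together they stay below \<open>26 / (1 - \<mu>)\<close>.\<close>

lemma gen_poisson_clt_smooth:
  fixes u u' :: "real \<Rightarrow> real"
  assumes \<mu>: "0 \<le> \<mu>" "\<mu> < 1" and \<theta>: "0 < \<theta>"
    and du: "\<And>x. (u has_real_derivative u' x) (at x)" and u': "\<And>x. \<bar>u' x\<bar> \<le> 1"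
    and m: "m = \<theta> / (1 - \<mu>)" and \<sigma>: "\<sigma> = sqrt (\<theta> / (1 - \<mu>) ^ 3)"
  shows "\<bar>measure_pmf.expectation (gen_poisson_pmf \<mu> \<theta>) (\<lambda>k. u ((real k - m) / \<sigma>))
      - std_normal_expectation u\<bar> \<le> 26 / ((1 - \<mu>)\<^sup>2 * \<sigma>)"
proof -
  obtain f f' where df: "\<And>x. (f has_real_derivative f' x) (at x)"
    and stein: "\<And>x. f' x - x * f x = u x - std_normal_expectation u"
    and f: "\<And>x. \<bar>f x\<bar> \<le> 3" and f': "\<And>x. \<bar>f' x\<bar> \<le> 8" and lipf': "\<And>x y. \<bar>f' x - f' y\<bar> \<le> 12 * \<bar>x - y\<bar>"
    using stein_solution[OF du u'] by blast
  define P where "P = gen_poisson_pmf \<mu> \<theta>"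
  define Y where "Y k = (real k - m) / \<sigma>" for k
  have \<sigma>0: "0 < \<sigma>" and \<sigma>2: "\<sigma>\<^sup>2 = \<theta> / (1 - \<mu>) ^ 3"
    using \<mu> \<theta> by (simp_all add: \<sigma>)
  have m\<sigma>: "m / (1 - \<mu>)\<^sup>2 = \<sigma>\<^sup>2"
    unfolding \<sigma>2 m by (simp add: power2_eq_square power3_eq_cube)
  have iP: "integrable P real"
    unfolding P_def using \<mu> \<theta> by (intro integrable_gen_poisson) auto
  have if': "integrable P (\<lambda>k. f' (Y k))"
    by (rule measure_pmf.integrable_const_bound[of _ 8]) (use f' in auto)
  have iYf: "integrable P (\<lambda>k. Y k * f (Y k))"
  proof (rule Bochner_Integration.integrable_bound[of _ "\<lambda>k. \<bar>Y k\<bar> * 3"])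
    show "integrable P (\<lambda>k. \<bar>Y k\<bar> * 3)" unfolding Y_def using iP by simp
    show "AE k in P. norm (Y k * f (Y k)) \<le> norm (\<bar>Y k\<bar> * 3)"
      using f by (intro AE_pmfI) (simp add: abs_mult mult_left_mono)
  qed simp
  have lip: "\<bar>u x - u y\<bar> \<le> \<bar>x - y\<bar>" for x y
    using field_differentiable_bound[of UNIV u u' 1 x y] du u' by simp
  have iu: "integrable P (\<lambda>k. u (Y k))"
    unfolding Y_def by (rule integrable_pmf_lipschitz[OF lip iP])
  have "measure_pmf.expectation P (\<lambda>k. u (Y k)) - std_normal_expectation u
      = measure_pmf.expectation P (\<lambda>k. u (Y k) - std_normal_expectation u)"
    using iu by simp
  also have "\<dots> = measure_pmf.expectation P (\<lambda>k. f' (Y k)) - measure_pmf.expectation P (\<lambda>k. Y k * f (Y k))"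
    unfolding stein[symmetric] using if' iYf by (rule Bochner_Integration.integral_diff)
  finally have start: "measure_pmf.expectation P (\<lambda>k. u (Y k)) - std_normal_expectation u = \<dots>" .
  have "(1 - \<mu>) * \<bar>measure_pmf.expectation P (\<lambda>k. (real k - m) * f ((real k - m) / \<sigma>))
      - m / (1 - \<mu>)\<^sup>2 * measure_pmf.expectation P (\<lambda>k. f' ((real k - m) / \<sigma>) / \<sigma>)\<bar>
    \<le> 2 * \<mu> * 3 / (1 - \<mu>) + 12 / \<sigma>\<^sup>2 * m / (1 - \<mu>) ^ 3
      + \<mu> / (1 - \<mu>) * (8 / \<sigma>) * sqrt (\<theta> / (1 - \<mu>) ^ 3)"
    unfolding P_def
  proof (rule gen_poisson_stein[OF \<mu> \<theta> _ f _ _ m])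
    show "((\<lambda>x. f ((x - m) / \<sigma>)) has_real_derivative f' ((x - m) / \<sigma>) / \<sigma>) (at x)" for x
    proof -
      have "((\<lambda>x. (x - m) / \<sigma>) has_real_derivative 1 / \<sigma>) (at x)"
        using \<sigma>0 by (auto intro!: derivative_eq_intros)
      from DERIV_chain2[OF df this] show ?thesis by simp
    qed
    show "\<bar>f' ((x - m) / \<sigma>) / \<sigma>\<bar> \<le> 8 / \<sigma>" for x
      using f' \<sigma>0 by (simp add: divide_right_mono)
    show "\<bar>f' ((x - m) / \<sigma>) / \<sigma> - f' ((y - m) / \<sigma>) / \<sigma>\<bar> \<le> 12 / \<sigma>\<^sup>2 * \<bar>x - y\<bar>" for x y
    proof -
      have "\<bar>f' ((x - m) / \<sigma>) / \<sigma> - f' ((y - m) / \<sigma>) / \<sigma>\<bar> = \<bar>f' ((x - m) / \<sigma>) - f' ((y - m) / \<sigma>)\<bar> / \<sigma>"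
        using \<sigma>0 by (simp add: diff_divide_distrib[symmetric])
      also have "\<dots> \<le> 12 * \<bar>(x - m) / \<sigma> - (y - m) / \<sigma>\<bar> / \<sigma>"
        using \<sigma>0 by (intro divide_right_mono lipf') auto
      also have "\<dots> = 12 / \<sigma>\<^sup>2 * \<bar>x - y\<bar>"
        using \<sigma>0 by (simp add: diff_divide_distrib[symmetric] power2_eq_square)
      finally show ?thesis .
    qed
  qed
  also have "measure_pmf.expectation P (\<lambda>k. (real k - m) * f ((real k - m) / \<sigma>))
      = \<sigma> * measure_pmf.expectation P (\<lambda>k. Y k * f (Y k))"
  proof -
    have "(real k - m) * f ((real k - m) / \<sigma>) = \<sigma> * (Y k * f (Y k))" for k
      using \<sigma>0 by (simp add: Y_def)
    then show ?thesis by simp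
  qed
  also have "measure_pmf.expectation P (\<lambda>k. f' ((real k - m) / \<sigma>) / \<sigma>)
      = measure_pmf.expectation P (\<lambda>k. f' (Y k)) / \<sigma>"
    unfolding Y_def by simp
  also have "m / (1 - \<mu>)\<^sup>2 * (measure_pmf.expectation P (\<lambda>k. f' (Y k)) / \<sigma>)
      = \<sigma> * measure_pmf.expectation P (\<lambda>k. f' (Y k))"
    unfolding m\<sigma> using \<sigma>0 by (simp add: power2_eq_square)
  also have "sqrt (\<theta> / (1 - \<mu>) ^ 3) = \<sigma>" by (simp add: \<sigma>)
  also have "12 / \<sigma>\<^sup>2 * m / (1 - \<mu>) ^ 3 = 12 / (1 - \<mu>)"
    unfolding \<sigma>2 m using \<mu> \<theta> by (simp add: field_simps)
  also have "2 * \<mu> * 3 / (1 - \<mu>) + 12 / (1 - \<mu>) + \<mu> / (1 - \<mu>) * (8 / \<sigma>) * \<sigma> = (14 * \<mu> + 12) / (1 - \<mu>)"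
    using \<sigma>0 by (simp add: add_divide_distrib)
  also have "\<dots> \<le> 26 / (1 - \<mu>)" using \<mu> by (intro divide_right_mono) auto
  also have "\<bar>\<sigma> * measure_pmf.expectation P (\<lambda>k. Y k * f (Y k)) - \<sigma> * measure_pmf.expectation P (\<lambda>k. f' (Y k))\<bar>
      = \<sigma> * \<bar>measure_pmf.expectation P (\<lambda>k. f' (Y k)) - measure_pmf.expectation P (\<lambda>k. Y k * f (Y k))\<bar>"
    using \<sigma>0 by (simp add: right_diff_distrib[symmetric] abs_mult abs_minus_commute)
  finally have fin: "(1 - \<mu>) * (\<sigma> * \<bar>measure_pmf.expectation P (\<lambda>k. f' (Y k))
      - measure_pmf.expectation P (\<lambda>k. Y k * f (Y k))\<bar>) \<le> 26 / (1 - \<mu>)" .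
  have "x \<le> 26 / ((1 - \<mu>)\<^sup>2 * \<sigma>)" if "(1 - \<mu>) * (\<sigma> * x) \<le> 26 / (1 - \<mu>)" for x
    using that \<mu> \<sigma>0 by (simp add: le_divide_eq power2_eq_square mult_ac)
  from this[OF fin] show ?thesis
    unfolding P_def[symmetric] Y_def[symmetric] start .
qed

text \<open>Smoothing with window \<open>1 / \<sigma>\<close> changes each of the two expectations
  by at most \<open>1 / \<sigma>\<close>, which raises 26 to 28.\<close>

lemma gen_poisson_clt:
  fixes u :: "real \<Rightarrow> real"
  assumes \<mu>: "0 \<le> \<mu>" "\<mu> < 1" and \<theta>: "0 < \<theta>"
    and lip: "\<And>x y. \<bar>u x - u y\<bar> \<le> \<bar>x - y\<bar>"
    and m: "m = \<theta> / (1 - \<mu>)" and \<sigma>: "\<sigma> = sqrt (\<theta> / (1 - \<mu>) ^ 3)"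
  shows "\<bar>measure_pmf.expectation (gen_poisson_pmf \<mu> \<theta>) (\<lambda>k. u ((real k - m) / \<sigma>))
      - std_normal_expectation u\<bar> \<le> 28 / ((1 - \<mu>)\<^sup>2 * \<sigma>)"
proof -
  define P where "P = gen_poisson_pmf \<mu> \<theta>"
  have \<sigma>0: "0 < \<sigma>"
    using \<mu> \<theta> by (simp add: \<sigma>)
  obtain v v' where dv: "\<And>x. (v has_real_derivative v' x) (at x)" and v': "\<And>x. \<bar>v' x\<bar> \<le> 1"
    and near: "\<And>x. \<bar>v x - u x\<bar> \<le> 1 / \<sigma>"
    using lipschitz_smooth_approx[OF lip, of "1 / \<sigma>"] \<sigma>0 by (metis zero_less_divide_1_iff)
  have lipv: "\<bar>v x - v y\<bar> \<le> \<bar>x - y\<bar>" for x y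
    using field_differentiable_bound[of UNIV v v' 1 x y] dv v' by simp
  have meas: "w \<in> borel_measurable borel" if "\<And>x y. \<bar>w x - w y\<bar> \<le> \<bar>x - y\<bar>" for w :: "real \<Rightarrow> real"
  proof (rule borel_measurable_continuous_onI)
    have "1-lipschitz_on UNIV w"
      using that by (intro lipschitz_onI) (auto simp: dist_real_def)
    then show "continuous_on UNIV w" by (rule lipschitz_on_continuous_on)
  qed
  have iP: "integrable P real"
    unfolding P_def using \<mu> \<theta> by (intro integrable_gen_poisson) auto
  have "\<bar>measure_pmf.expectation P (\<lambda>k. v ((real k - m) / \<sigma>)) - std_normal_expectation v\<bar>
      \<le> 26 / ((1 - \<mu>)\<^sup>2 * \<sigma>)"
    unfolding P_def by (rule gen_poisson_clt_smooth[OF \<mu> \<theta> dv v' m \<sigma>])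
  moreover have "\<bar>measure_pmf.expectation P (\<lambda>k. v ((real k - m) / \<sigma>))
      - measure_pmf.expectation P (\<lambda>k. u ((real k - m) / \<sigma>))\<bar> \<le> 1 / \<sigma>"
  proof -
    note i = integrable_pmf_lipschitz[OF lipv iP, of m \<sigma>] integrable_pmf_lipschitz[OF lip iP, of m \<sigma>]
    have "\<bar>measure_pmf.expectation P (\<lambda>k. v ((real k - m) / \<sigma>) - u ((real k - m) / \<sigma>))\<bar>
        \<le> measure_pmf.expectation P (\<lambda>k. \<bar>v ((real k - m) / \<sigma>) - u ((real k - m) / \<sigma>)\<bar>)"
      by (rule integral_abs_bound)
    also have "\<dots> \<le> measure_pmf.expectation P (\<lambda>_. 1 / \<sigma>)"
      by (rule integral_mono[OF integrable_abs[OF Bochner_Integration.integrable_diff[OF i]]])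
         (auto simp: near)
    finally show ?thesis using i by simp
  qed
  moreover have "\<bar>std_normal_expectation v - std_normal_expectation u\<bar> \<le> 1 / \<sigma>"
  proof -
    have i: "integrable lborel (\<lambda>x. std_normal_density x * v x)" "integrable lborel (\<lambda>x. std_normal_density x * u x)"
      by (rule integrable_std_normal_linear_growth[OF meas lipschitz_linear_growth], rule lipv, rule lipv)
         (rule integrable_std_normal_linear_growth[OF meas lipschitz_linear_growth], rule lip, rule lip)
    have "\<bar>\<integral>x. std_normal_density x * v x - std_normal_density x * u x \<partial>lborel\<bar>
        \<le> (\<integral>x. \<bar>std_normal_density x * v x - std_normal_density x * u x\<bar> \<partial>lborel)"
      by (rule integral_abs_bound)
    also have "\<dots> \<le> std_normal_expectation (\<lambda>_. 1 / \<sigma>)"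
    proof (rule integral_mono[OF integrable_abs[OF Bochner_Integration.integrable_diff[OF i]]])
      show "integrable lborel (\<lambda>x. std_normal_density x * (1 / \<sigma>))"
        using integrable_std_normal_moment[of 0] by simp
      show "\<bar>std_normal_density x * v x - std_normal_density x * u x\<bar> \<le> std_normal_density x * (1 / \<sigma>)" for x
        using mult_left_mono[OF near, of "std_normal_density x" x]
        by (simp add: right_diff_distrib[symmetric] abs_mult)
    qed
    also have "\<dots> = 1 / \<sigma>" using integral_std_normal_moment_even[of 0] by simp
    finally show ?thesis using i by simp
  qed
  ultimately have "\<bar>measure_pmf.expectation P (\<lambda>k. u ((real k - m) / \<sigma>)) - std_normal_expectation u\<bar>
      \<le> 26 / ((1 - \<mu>)\<^sup>2 * \<sigma>) + 2 * (1 / \<sigma>)"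
    by linarith
  also have "1 / \<sigma> \<le> 1 / ((1 - \<mu>)\<^sup>2 * \<sigma>)"
    using \<mu> \<sigma>0 by (intro divide_left_mono) (auto simp: power_le_one mult_le_cancel_right1)
  finally show ?thesis by (simp add: P_def mult.commute)
qed

section \<open>The Hawkes process\<close>

text \<open>Position \<open>i\<close> of the list lies \<open>Suc i\<close> steps before the value
  about to be drawn, so the rate needs no time index.\<close>

definition next_rate :: "(nat \<Rightarrow> real) \<Rightarrow> nat list \<Rightarrow> real" where
  "next_rate \<alpha> xs = \<alpha> 0 + (\<Sum>i<length xs. \<alpha> (Suc i) * real (xs ! i))"

text \<open>Histories are lists with the most recent value first.\<close>

primrec hawkes_pmf :: "(nat \<Rightarrow> real) \<Rightarrow> nat \<Rightarrow> nat list pmf" where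
  "hawkes_pmf \<alpha> 0 = return_pmf []"
| "hawkes_pmf \<alpha> (Suc n) =
     bind_pmf (hawkes_pmf \<alpha> n) (\<lambda>xs. map_pmf (\<lambda>x. x # xs) (poisson_pmf (next_rate \<alpha> xs)))"

primrec hawkes_path :: "(nat \<Rightarrow> 'a \<Rightarrow> nat) \<Rightarrow> nat \<Rightarrow> 'a \<Rightarrow> nat list" where
  "hawkes_path X 0 \<omega> = []"
| "hawkes_path X (Suc n) \<omega> = X (Suc n) \<omega> # hawkes_path X n \<omega>"

lemma length_hawkes_path [simp]: "length (hawkes_path X n \<omega>) = n"
  by (induction n) auto

lemma nth_hawkes_path: "i < n \<Longrightarrow> hawkes_path X n \<omega> ! i = X (n - i) \<omega>"
  by (induction n arbitrary: i) (auto simp: nth_Cons split: nat.split)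

lemma sum_list_hawkes_path: "sum_list (hawkes_path X n \<omega>) = hawkes_count X n \<omega>"
  by (induction n) (auto simp: hawkes_count_def)

lemma hawkes_intensity_path: "hawkes_intensity \<alpha> X (Suc n) \<omega> = next_rate \<alpha> (hawkes_path X n \<omega>)"
proof -
  have "(\<Sum>i\<in>{1..<Suc n}. \<alpha> (Suc n - i) * real (X i \<omega>)) = (\<Sum>i<n. \<alpha> (Suc i) * real (X (n - i) \<omega>))"
    by (rule sum.reindex_bij_witness[of _ "\<lambda>i. n - i" "\<lambda>i. n - i"]) (auto simp: Suc_diff_le)
  then show ?thesis
    by (simp add: hawkes_intensity_def next_rate_def nth_hawkes_path)
qed

section \<open>Law of the observed history\<close>

context discrete_hawkes
begin

lemma space_hawkes_past: "space (hawkes_past M X k) = space M"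
  unfolding hawkes_past_def by (rule space_measure_of) auto

lemma sets_hawkes_past:
  "sets (hawkes_past M X k)
     = sigma_sets (space M) (\<Union>i\<in>{1..<k}. {X i -` A \<inter> space M | A. A \<subseteq> UNIV})"
  unfolding hawkes_past_def by (rule sets_measure_of) auto

lemma subalgebra_hawkes_past: "subalgebra M (hawkes_past M X k)"
  unfolding subalgebra_def space_hawkes_past sets_hawkes_past
  by (auto intro!: sets.sigma_sets_subset measurable_sets[OF measurable_X])

text \<open>Adaptedness: it allows the indicator of such an event to be used as a test function for
  the conditional expectation given the past.\<close>

lemma hawkes_path_event:
  assumes "m < k"
  shows "{\<omega> \<in> space M. hawkes_path X m \<omega> = xs} \<in> sets (hawkes_past M X k)"
  using assms
proof (induction m arbitrary: xs)
  case 0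
  show ?case
    using sets.top[of "hawkes_past M X k"] by (simp add: space_hawkes_past)
next
  case (Suc m)
  show ?case
  proof (cases xs)
    case (Cons y ys)
    have "X (Suc m) -` {y} \<inter> space M \<in> sets (hawkes_past M X k)"
      unfolding sets_hawkes_past using Suc.prems
      by (intro sigma_sets.Basic) (auto intro!: bexI[of _ "Suc m"])
    moreover have "{\<omega> \<in> space M. hawkes_path X m \<omega> = ys} \<in> sets (hawkes_past M X k)"
      using Suc by simp
    moreover have "{\<omega> \<in> space M. hawkes_path X (Suc m) \<omega> = xs}
        = (X (Suc m) -` {y} \<inter> space M) \<inter> {\<omega> \<in> space M. hawkes_path X m \<omega> = ys}"
      using Cons by auto
    ultimately show ?thesis by auto
  qed simp
qed

lemma measurable_hawkes_path: "hawkes_path X n \<in> measurable M (count_space UNIV)"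
proof (rule measurable_count_space_eq2_countable[THEN iffD2, rotated], safe)
  fix xs
  have "{\<omega> \<in> space M. hawkes_path X n \<omega> = xs} \<in> sets M"
    using hawkes_path_event[of n "Suc n" xs] subalgebra_hawkes_past unfolding subalgebra_def by auto
  then show "hawkes_path X n -` {xs} \<inter> space M \<in> sets M"
    by (simp add: vimage_def Int_def conj_commute)
qed auto

text \<open>On the event that the past equals \<open>ys\<close> the intensity is constant, so
  integrating the conditional law over that event gives a plain product. The almost sure conditional
  statements thus become a recursion for point masses on a countable space.\<close>

lemma prob_hawkes_path:
  "prob {\<omega> \<in> space M. hawkes_path X n \<omega> = xs} = pmf (hawkes_pmf \<alpha> n) xs"
proof (induction n arbitrary: xs)
  case 0
  show ?case by (cases "xs = []") (auto simp: prob_space)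
next
  case (Suc n)
  show ?case
  proof (cases xs)
    case Nil
    then show ?thesis by (auto simp: pmf_eq_0_set_pmf)
  next
    case (Cons y ys)
    define F where "F = hawkes_past M X (Suc n)"
    define E where "E = {\<omega> \<in> space M. hawkes_path X n \<omega> = ys}"
    define S where "S = X (Suc n) -` {y} \<inter> space M"
    define c where "c = pmf (poisson_pmf (next_rate \<alpha> ys)) y"
    interpret finite_measure_subalgebra M F
      by unfold_locales (simp add: F_def subalgebra_hawkes_past)
    have E_F: "E \<in> sets F" unfolding E_def F_def by (rule hawkes_path_event) simp
    have E_M: "E \<in> sets M" using E_F subalg by (auto simp: subalgebra_def)
    have S_M: "S \<in> sets M" unfolding S_def by (rule measurable_sets[OF measurable_X]) auto
    have "prob (E \<inter> S) = (\<integral>\<omega>. indicator E \<omega> * indicator S \<omega> \<partial>M)"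
      using E_M S_M by (simp flip: indicator_inter_arith)
    also have "\<dots> = (\<integral>\<omega>. indicator E \<omega> * real_cond_exp M F (indicator S) \<omega> \<partial>M)"
      using E_F E_M S_M by (intro real_cond_exp_intg(2)[symmetric])
        (auto simp flip: indicator_inter_arith intro!: integrable_real_indicator simp: emeasure_eq_measure)
    also have "\<dots> = (\<integral>\<omega>. indicator E \<omega> * c \<partial>M)"
    proof (rule integral_cong_AE)
      have "AE \<omega> in M. real_cond_exp M F (indicator S) \<omega>
          = measure_pmf.prob (poisson_pmf (hawkes_intensity \<alpha> X (Suc n) \<omega>)) {y}"
        using cond_law_X[of "Suc n"] unfolding has_cond_law_def F_def S_def by simp
      then show "AE \<omega> in M. indicator E \<omega> * real_cond_exp M F (indicator S) \<omega> = indicator E \<omega> * c"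
        by eventually_elim
          (auto simp: hawkes_intensity_path E_def c_def measure_pmf_single indicator_def)
    qed (use E_M in \<open>auto\<close>)
    also have "\<dots> = prob E * c" using E_M by simp
    also have "prob E = pmf (hawkes_pmf \<alpha> n) ys" unfolding E_def by (rule Suc.IH)
    also have "pmf (hawkes_pmf \<alpha> n) ys * c = pmf (hawkes_pmf \<alpha> (Suc n)) xs"
    proof -
      have "pmf (map_pmf (\<lambda>x. x # zs) (poisson_pmf (next_rate \<alpha> zs))) (y # ys)
          = indicator {ys} zs * c" for zs
      proof (cases "zs = ys")
        case True
        then show ?thesis
          using pmf_map_inj'[of "\<lambda>x. x # zs" "poisson_pmf (next_rate \<alpha> zs)" y]
          by (simp add: c_def inj_def)
      next
        case False
        then show ?thesis by (auto simp: pmf_eq_0_set_pmf)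
      qed
      then show ?thesis
        unfolding Cons by (simp add: pmf_bind measure_pmf_single)
    qed
    also have "E \<inter> S = {\<omega> \<in> space M. hawkes_path X (Suc n) \<omega> = xs}"
      by (auto simp: E_def S_def Cons)
    finally show ?thesis .
  qed
qed

lemma distr_hawkes_path: "distr M (count_space UNIV) (hawkes_path X n) = measure_pmf (hawkes_pmf \<alpha> n)"
proof (rule measure_eqI_countable)
  fix xs
  have "emeasure (distr M (count_space UNIV) (hawkes_path X n)) {xs}
      = prob {\<omega> \<in> space M. hawkes_path X n \<omega> = xs}"
    by (subst emeasure_distr[OF measurable_hawkes_path])
       (auto simp: emeasure_eq_measure vimage_def Int_def conj_commute)
  then show "emeasure (distr M (count_space UNIV) (hawkes_path X n)) {xs}
      = emeasure (measure_pmf (hawkes_pmf \<alpha> n)) {xs}"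
    by (simp add: prob_hawkes_path emeasure_pmf_single)
qed auto

lemma integral_hawkes_count:
  assumes [measurable]: "u \<in> borel_measurable borel"
  shows "(\<integral>x. u x \<partial>distr M borel (\<lambda>\<omega>. (real (hawkes_count X n \<omega>) - a) / b))
    = measure_pmf.expectation (hawkes_pmf \<alpha> n) (\<lambda>xs. u ((real (sum_list xs) - a) / b) :: real)"
proof -
  note [measurable] = measurable_hawkes_path
  have "(\<lambda>\<omega>. (real (sum_list (hawkes_path X n \<omega>)) - a) / b) \<in> borel_measurable M"
    by (rule measurable_compose[OF measurable_hawkes_path]) simp
  then have "(\<integral>x. u x \<partial>distr M borel (\<lambda>\<omega>. (real (sum_list (hawkes_path X n \<omega>)) - a) / b))
    = (\<integral>\<omega>. u ((real (sum_list (hawkes_path X n \<omega>)) - a) / b) \<partial>M)"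
    by (rule integral_distr) simp
  also have "\<dots> = measure_pmf.expectation (hawkes_pmf \<alpha> n) (\<lambda>xs. u ((real (sum_list xs) - a) / b))"
    unfolding distr_hawkes_path[symmetric]
    by (rule integral_distr[symmetric, OF measurable_hawkes_path]) simp
  finally show ?thesis by (simp add: sum_list_hawkes_path)
qed

end

section \<open>Unborn descendants and the coupling with the total progeny\<close>

locale subcritical_kernel =
  fixes \<alpha> :: "nat \<Rightarrow> real" and \<mu> :: real
  assumes \<alpha>_pos: "\<alpha> k > 0"
    and summable_\<alpha>: "summable \<alpha>"
    and \<mu>_def: "\<mu> = (\<Sum>k. \<alpha> (Suc k))"
    and \<mu>_less_1: "\<mu> < 1"
    and summable_first_moment: "summable (\<lambda>k. real k * \<alpha> k)"
begin

text \<open>The kernel mass that an event at position \<open>i\<close> of the history has left: the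
  next value sees it at lag \<open>Suc i\<close>.\<close>

definition tail :: "nat \<Rightarrow> real" where
  "tail i = (\<Sum>j. \<alpha> (j + Suc i))"

text \<open>The expected number of direct offspring still to come of the events in the history.\<close>

definition pending :: "nat list \<Rightarrow> real" where
  "pending xs = (\<Sum>i<length xs. tail i * real (xs ! i))"

lemma \<mu>_nonneg: "0 \<le> \<mu>"
  unfolding \<mu>_def using \<alpha>_pos summable_\<alpha> by (intro suminf_nonneg) (auto simp: summable_Suc_iff intro: less_imp_le)

lemma tail_nonneg: "0 \<le> tail i"
  unfolding tail_def using \<alpha>_pos summable_\<alpha>
  by (intro suminf_nonneg) (auto simp: summable_iff_shift intro: less_imp_le simp del: add_Suc_right)

lemma tail_0: "tail 0 = \<mu>"
  by (simp add: tail_def \<mu>_def)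

lemma tail_rec: "tail i = \<alpha> (Suc i) + tail (Suc i)"
proof -
  have "summable (\<lambda>j. \<alpha> (j + Suc i))"
    using summable_\<alpha> by (simp only: summable_iff_shift)
  from suminf_split_head[OF this] show ?thesis
    by (simp add: tail_def)
qed

text \<open>The value \<open>\<alpha> k\<close> occurs in \<open>tail i\<close> exactly for
  \<open>i < k\<close>, hence at most \<open>k\<close> times in the sum. Here the first moment of
  the kernel makes the bound uniform in \<open>n\<close>.\<close>

lemma sum_tail_le: "(\<Sum>i<n. tail i) \<le> (\<Sum>k. real k * \<alpha> k)"
proof -
  define f where "f k i = (if i < k then \<alpha> k else 0)" for k i :: nat
  have f: "summable (\<lambda>k. f k i)" for i
    by (rule summable_comparison_test'[OF summable_\<alpha>]) (use \<alpha>_pos in \<open>auto simp: f_def intro: less_imp_le\<close>)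
  have tail: "tail i = (\<Sum>k. f k i)" for i
    unfolding tail_def using suminf_split_initial_segment[OF f, of i "Suc i"] by (simp add: f_def)
  have "(\<Sum>i<n. tail i) = (\<Sum>k. \<Sum>i<n. f k i)"
    unfolding tail by (rule suminf_sum[symmetric]) (rule f)
  also have "\<dots> \<le> (\<Sum>k. real k * \<alpha> k)"
  proof (intro suminf_le summable_sum f summable_first_moment)
    fix k
    have "(\<Sum>i<n. f k i) = (\<Sum>i\<in>{..<n} \<inter> {i. i < k}. \<alpha> k)"
      unfolding f_def by (subst sum.inter_restrict) (auto intro: sum.cong)
    also have "\<dots> \<le> real k * \<alpha> k"
    proof -
      have "card ({..<n} \<inter> {i. i < k}) \<le> card {..<k}" by (intro card_mono) auto
      then show ?thesis using \<alpha>_pos[of k] by (simp add: mult_right_mono)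
    qed
    finally show "(\<Sum>i<n. f k i) \<le> real k * \<alpha> k" .
  qed
  finally show ?thesis .
qed

lemma next_rate_pos: "0 < next_rate \<alpha> xs"
  unfolding next_rate_def using \<alpha>_pos
  by (intro add_pos_nonneg sum_nonneg mult_nonneg_nonneg) (auto intro: less_imp_le)

lemma pending_nonneg: "0 \<le> pending xs"
  unfolding pending_def by (intro sum_nonneg mult_nonneg_nonneg tail_nonneg) auto

lemma pending_decomp: "pending xs = next_rate \<alpha> xs - \<alpha> 0 + (\<Sum>i<length xs. tail (Suc i) * real (xs ! i))"
  unfolding pending_def next_rate_def by (subst tail_rec) (simp add: distrib_right sum.distrib)

text \<open>Balance of one step: the offspring rate
  \<open>next_rate \<alpha> xs - \<alpha> 0\<close> is used up, and each of the \<open>x\<close> new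
  events brings its full mean \<open>\<mu>\<close>.\<close>

lemma pending_Cons: "pending (x # xs) = \<mu> * real x + (pending xs - (next_rate \<alpha> xs - \<alpha> 0))"
  unfolding pending_decomp[of xs] by (simp add: pending_def sum.lessThan_Suc_shift tail_0 del: sum.lessThan_Suc)

lemma next_rate_le_pending: "next_rate \<alpha> xs - \<alpha> 0 \<le> pending xs"
  unfolding pending_decomp by (simp add: sum_nonneg tail_nonneg)

text \<open>The parameter \<open>a\<close> accounts for the immigrants of the steps not yet taken in the induction.\<close>

lemma hawkes_pmf_total_progeny:
  assumes "0 \<le> a"
  shows "bind_pmf (hawkes_pmf \<alpha> n) (\<lambda>xs. map_pmf ((+) (sum_list xs)) (gen_poisson_pmf \<mu> (pending xs + a)))
    = gen_poisson_pmf \<mu> (real n * \<alpha> 0 + a)"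
  using assms
proof (induction n arbitrary: a)
  case 0
  have "map_pmf ((+) 0) p = p" for p :: "nat pmf"
    by (simp add: map_pmf_ident[unfolded id_def] cong: map_pmf_cong)
  then show ?case by (simp add: bind_return_pmf pending_def)
next
  case (Suc n)
  have "bind_pmf (poisson_pmf (next_rate \<alpha> xs))
      (\<lambda>x. map_pmf ((+) (sum_list (x # xs))) (gen_poisson_pmf \<mu> (pending (x # xs) + a)))
    = map_pmf ((+) (sum_list xs)) (gen_poisson_pmf \<mu> (pending xs + (\<alpha> 0 + a)))" for xs
  proof -
    \<comment> \<open>What stays pending once the rate of the next step is taken out. Then
      \<open>next_rate \<alpha> xs + b\<close> equals \<open>pending xs + (\<alpha> 0 + a)\<close>,
      so undoing the step moves its immigration rate into the parameter \<open>a\<close>.\<close>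
    define b where "b = pending xs - (next_rate \<alpha> xs - \<alpha> 0) + a"
    have add: "map_pmf ((+) (sum_list (x # xs))) p = map_pmf ((+) (sum_list xs)) (map_pmf ((+) x) p)"
      for x and p :: "nat pmf"
      unfolding map_pmf_comp by (rule map_pmf_cong) auto
    have pending: "pending (x # xs) + a = b + (\<mu> - 0) * real x" for x
      by (simp add: pending_Cons b_def)
    have b: "0 \<le> b" using next_rate_le_pending[of xs] Suc.prems by (simp add: b_def)
    have "bind_pmf (poisson_pmf (next_rate \<alpha> xs))
      (\<lambda>x. map_pmf ((+) (sum_list (x # xs))) (gen_poisson_pmf \<mu> (pending (x # xs) + a)))
      = bind_pmf (gen_poisson_pmf 0 (next_rate \<alpha> xs))
      (\<lambda>x. map_pmf ((+) (sum_list xs)) (map_pmf ((+) x) (gen_poisson_pmf \<mu> (b + (\<mu> - 0) * real x))))"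
      unfolding add pending by (simp only: gen_poisson_pmf_0 next_rate_pos)
    also have "\<dots> = map_pmf ((+) (sum_list xs)) (gen_poisson_pmf \<mu> (next_rate \<alpha> xs + b))"
      unfolding map_bind_pmf[symmetric] using gen_poisson_pmf_bind[of 0 \<mu> "next_rate \<alpha> xs" b]
      by (simp add: \<mu>_nonneg \<mu>_less_1 b next_rate_pos less_imp_le)
    also have "next_rate \<alpha> xs + b = pending xs + (\<alpha> 0 + a)" by (simp add: b_def)
    finally show ?thesis .
  qed
  then have "bind_pmf (hawkes_pmf \<alpha> (Suc n))
      (\<lambda>xs. map_pmf ((+) (sum_list xs)) (gen_poisson_pmf \<mu> (pending xs + a)))
    = bind_pmf (hawkes_pmf \<alpha> n)
      (\<lambda>xs. map_pmf ((+) (sum_list xs)) (gen_poisson_pmf \<mu> (pending xs + (\<alpha> 0 + a))))"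
    by (simp add: bind_assoc_pmf bind_map_pmf)
  also have "\<dots> = gen_poisson_pmf \<mu> (real n * \<alpha> 0 + (\<alpha> 0 + a))"
    using Suc.prems \<alpha>_pos[of 0] by (intro Suc.IH) simp
  also have "real n * \<alpha> 0 + (\<alpha> 0 + a) = real (Suc n) * \<alpha> 0 + a"
    by (simp add: algebra_simps)
  finally show ?case .
qed

text \<open>In effect every value has mean at most \<open>\<alpha> 0 / (1 - \<mu>)\<close>, the
  fixed point of \<open>s = \<alpha> 0 + \<mu> * s\<close>. Integrating out the most recent value
  turns the coefficients \<open>c\<close> into \<open>d\<close> with an added constant, which is why
  the induction runs over all nonnegative \<open>c\<close>.\<close>

lemma hawkes_pmf_linear_functional_le:
  assumes "\<And>i. 0 \<le> c i"
  shows "(\<integral>\<^sup>+xs. ennreal (\<Sum>i<length xs. c i * real (xs ! i)) \<partial>hawkes_pmf \<alpha> n)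
    \<le> ennreal (\<alpha> 0 / (1 - \<mu>) * (\<Sum>i<n. c i))"
  using assms
proof (induction n arbitrary: c)
  case 0
  then show ?case by simp
next
  case (Suc n)
  define s where "s = \<alpha> 0 / (1 - \<mu>)"
  have s: "0 \<le> s" "\<alpha> 0 + \<mu> * s = s"
    using \<alpha>_pos[of 0] \<mu>_less_1 by (auto simp: s_def field_simps)
  define d where "d i = c 0 * \<alpha> (Suc i) + c (Suc i)" for i
  have d: "0 \<le> d i" for i
    unfolding d_def using Suc.prems \<alpha>_pos by (simp add: less_imp_le)
  have step: "(\<integral>\<^sup>+x. ennreal (\<Sum>i<length (x # xs). c i * real ((x # xs) ! i)) \<partial>poisson_pmf (next_rate \<alpha> xs))
      = ennreal (c 0 * \<alpha> 0) + ennreal (\<Sum>i<length xs. d i * real (xs ! i))" for xs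
  proof -
    have "(\<integral>\<^sup>+x. ennreal (\<Sum>i<length (x # xs). c i * real ((x # xs) ! i)) \<partial>poisson_pmf (next_rate \<alpha> xs))
      = (\<integral>\<^sup>+x. ennreal ((\<Sum>i<length xs. c (Suc i) * real (xs ! i)) + c 0 * real x) \<partial>gen_poisson_pmf 0 (next_rate \<alpha> xs))"
      by (simp add: gen_poisson_pmf_0 next_rate_pos sum.lessThan_Suc_shift add.commute del: sum.lessThan_Suc)
    also have "\<dots> = ennreal ((\<Sum>i<length xs. c (Suc i) * real (xs ! i)) + c 0 * (next_rate \<alpha> xs / (1 - 0)))"
      using Suc.prems next_rate_pos[of xs]
      by (intro nn_integral_gen_poisson_affine) (auto intro!: sum_nonneg)
    also have "(\<Sum>i<length xs. c (Suc i) * real (xs ! i)) + c 0 * (next_rate \<alpha> xs / (1 - 0))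
        = c 0 * \<alpha> 0 + (\<Sum>i<length xs. d i * real (xs ! i))"
      by (simp add: next_rate_def d_def algebra_simps sum.distrib sum_distrib_left)
    also have "ennreal \<dots> = ennreal (c 0 * \<alpha> 0) + ennreal (\<Sum>i<length xs. d i * real (xs ! i))"
      using Suc.prems \<alpha>_pos[of 0] d by (intro ennreal_plus) (auto intro!: sum_nonneg)
    finally show ?thesis .
  qed
  have "(\<integral>\<^sup>+xs. ennreal (\<Sum>i<length xs. c i * real (xs ! i)) \<partial>hawkes_pmf \<alpha> (Suc n))
      = ennreal (c 0 * \<alpha> 0) + (\<integral>\<^sup>+xs. ennreal (\<Sum>i<length xs. d i * real (xs ! i)) \<partial>hawkes_pmf \<alpha> n)"
    unfolding hawkes_pmf.simps nn_integral_bind_pmf nn_integral_map_pmf step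
    by (simp add: nn_integral_add)
  also have "\<dots> \<le> ennreal (c 0 * \<alpha> 0) + ennreal (s * (\<Sum>i<n. d i))"
    unfolding s_def by (intro add_left_mono Suc.IH d)
  also have "\<dots> = ennreal (c 0 * \<alpha> 0 + s * (\<Sum>i<n. d i))"
    using Suc.prems \<alpha>_pos[of 0] d s
    by (intro ennreal_plus[symmetric] mult_nonneg_nonneg sum_nonneg) auto
  also have "\<dots> \<le> ennreal (s * (\<Sum>i<Suc n. c i))"
  proof (rule ennreal_leI)
    have "(\<Sum>i<n. \<alpha> (Suc i)) \<le> \<mu>"
      unfolding \<mu>_def using summable_\<alpha> \<alpha>_pos
      by (intro sum_le_suminf) (auto simp: summable_Suc_iff less_imp_le)
    then have "c 0 * (\<alpha> 0 + s * (\<Sum>i<n. \<alpha> (Suc i))) \<le> c 0 * (\<alpha> 0 + s * \<mu>)"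
      using Suc.prems s by (intro mult_left_mono add_left_mono) auto
    also have "\<dots> = s * c 0" using s(2) by (simp add: mult.commute)
    finally show "c 0 * \<alpha> 0 + s * (\<Sum>i<n. d i) \<le> s * (\<Sum>i<Suc n. c i)"
      unfolding sum.lessThan_Suc_shift d_def by (simp add: sum.distrib sum_distrib_left[symmetric] algebra_simps)
  qed
  finally show ?case by (simp add: s_def)
qed

text \<open>\<open>K\<close> couples the count with the count plus its unborn descendants, whose
  second marginal is \<open>hawkes_pmf_total_progeny\<close> at \<open>a = 0\<close>. The mean gap
  is that of \<open>pending xs / (1 - \<mu>)\<close>. One factor \<open>1 / (1 - \<mu>)\<close> is
  the mean tree size, the other bounds the mean of the values, and \<open>sum_tail_le\<close> bounds
  the weights.\<close>

lemma hawkes_count_coupling: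
  fixes \<phi> :: "nat \<Rightarrow> real"
  assumes lip: "\<And>j k. \<bar>\<phi> j - \<phi> k\<bar> \<le> L * \<bar>real j - real k\<bar>"
  shows "\<bar>measure_pmf.expectation (hawkes_pmf \<alpha> n) (\<lambda>xs. \<phi> (sum_list xs))
      - measure_pmf.expectation (gen_poisson_pmf \<mu> (real n * \<alpha> 0)) \<phi>\<bar>
    \<le> L * (\<alpha> 0 / (1 - \<mu>)\<^sup>2 * (\<Sum>k. real k * \<alpha> k))"
proof -
  define K where "K = bind_pmf (hawkes_pmf \<alpha> n)
    (\<lambda>xs. map_pmf (\<lambda>j. (sum_list xs, sum_list xs + j)) (gen_poisson_pmf \<mu> (pending xs)))"
  have K1: "map_pmf fst K = map_pmf sum_list (hawkes_pmf \<alpha> n)"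
    by (simp add: K_def map_bind_pmf map_pmf_comp map_pmf_def[of sum_list])
  have K2: "map_pmf snd K = gen_poisson_pmf \<mu> (real n * \<alpha> 0)"
    using hawkes_pmf_total_progeny[of 0 n] by (simp add: K_def map_bind_pmf map_pmf_comp)
  define \<Delta> where "\<Delta> z = \<bar>real (fst z) - real (snd z)\<bar>" for z :: "nat \<times> nat"
  define B where "B = \<alpha> 0 / (1 - \<mu>)\<^sup>2 * (\<Sum>k. real k * \<alpha> k)"
  have L: "0 \<le> L" using lip[of 1 0] by simp
  have B: "0 \<le> B"
    unfolding B_def using \<alpha>_pos summable_first_moment
    by (intro mult_nonneg_nonneg suminf_nonneg divide_nonneg_nonneg) (auto intro: less_imp_le)
  have "(\<integral>\<^sup>+z. ennreal (\<Delta> z) \<partial>K)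
      = (\<integral>\<^sup>+xs. \<integral>\<^sup>+j. ennreal (0 + 1 * real j) \<partial>gen_poisson_pmf \<mu> (pending xs) \<partial>hawkes_pmf \<alpha> n)"
    by (simp add: K_def \<Delta>_def)
  also have "\<dots> = (\<integral>\<^sup>+xs. ennreal (pending xs / (1 - \<mu>)) \<partial>hawkes_pmf \<alpha> n)"
    by (subst nn_integral_gen_poisson_affine) (auto simp: \<mu>_nonneg \<mu>_less_1 pending_nonneg)
  also have "\<dots> = (\<integral>\<^sup>+xs. ennreal (\<Sum>i<length xs. tail i / (1 - \<mu>) * real (xs ! i)) \<partial>hawkes_pmf \<alpha> n)"
    by (simp add: pending_def sum_divide_distrib)
  also have "\<dots> \<le> ennreal (\<alpha> 0 / (1 - \<mu>) * (\<Sum>i<n. tail i / (1 - \<mu>)))"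
    using \<mu>_less_1 by (intro hawkes_pmf_linear_functional_le) (simp add: tail_nonneg)
  also have "\<dots> \<le> ennreal B"
  proof (rule ennreal_leI)
    have "\<alpha> 0 / (1 - \<mu>) * (\<Sum>i<n. tail i / (1 - \<mu>)) = \<alpha> 0 / (1 - \<mu>)\<^sup>2 * (\<Sum>i<n. tail i)"
      by (simp add: sum_divide_distrib[symmetric] power2_eq_square)
    also have "\<dots> \<le> B"
      unfolding B_def using \<alpha>_pos[of 0] by (intro mult_left_mono sum_tail_le) auto
    finally show "\<alpha> 0 / (1 - \<mu>) * (\<Sum>i<n. tail i / (1 - \<mu>)) \<le> B" .
  qed
  finally have \<Delta>_le: "(\<integral>\<^sup>+z. ennreal (\<Delta> z) \<partial>K) \<le> ennreal B" .
  then have i\<Delta>: "integrable K \<Delta>"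
    by (intro integrableI_bounded) (auto simp: \<Delta>_def intro: le_less_trans)
  have E\<Delta>: "measure_pmf.expectation K \<Delta> \<le> B"
    using \<Delta>_le nn_integral_eq_integral[OF i\<Delta>] B by (simp add: \<Delta>_def)
  have i2: "integrable K (\<lambda>z. \<phi> (snd z))"
  proof -
    have "integrable (gen_poisson_pmf \<mu> (real n * \<alpha> 0)) \<phi>"
    proof (rule Bochner_Integration.integrable_bound[of _ "\<lambda>k. \<bar>\<phi> 0\<bar> + L * real k"])
      show "integrable (gen_poisson_pmf \<mu> (real n * \<alpha> 0)) (\<lambda>k. \<bar>\<phi> 0\<bar> + L * real k)"
        using integrable_gen_poisson[OF \<mu>_nonneg \<mu>_less_1, of "real n * \<alpha> 0"] \<alpha>_pos[of 0] by simp
      show "AE k in gen_poisson_pmf \<mu> (real n * \<alpha> 0). norm (\<phi> k) \<le> norm (\<bar>\<phi> 0\<bar> + L * real k)"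
      proof (rule AE_pmfI)
        fix k
        show "norm (\<phi> k) \<le> norm (\<bar>\<phi> 0\<bar> + L * real k)"
          using lip[of k 0] L by simp
      qed
    qed simp
    then show ?thesis unfolding K2[symmetric] by simp
  qed
  have iD: "integrable K (\<lambda>z. \<phi> (fst z) - \<phi> (snd z))"
    by (rule Bochner_Integration.integrable_bound[OF integrable_mult_right[OF i\<Delta>, of L]])
       (use lip L in \<open>auto intro!: AE_pmfI simp: \<Delta>_def abs_mult\<close>)
  have i1: "integrable K (\<lambda>z. \<phi> (fst z))"
    using Bochner_Integration.integrable_add[OF iD i2] by simp
  have "measure_pmf.expectation (hawkes_pmf \<alpha> n) (\<lambda>xs. \<phi> (sum_list xs))
      = measure_pmf.expectation (map_pmf fst K) \<phi>"
    unfolding K1 by simp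
  then have "\<bar>measure_pmf.expectation (hawkes_pmf \<alpha> n) (\<lambda>xs. \<phi> (sum_list xs))
      - measure_pmf.expectation (gen_poisson_pmf \<mu> (real n * \<alpha> 0)) \<phi>\<bar>
    = \<bar>measure_pmf.expectation K (\<lambda>z. \<phi> (fst z) - \<phi> (snd z))\<bar>"
    using i1 i2 unfolding K2[symmetric] by simp
  also have "\<dots> \<le> measure_pmf.expectation K (\<lambda>z. \<bar>\<phi> (fst z) - \<phi> (snd z)\<bar>)"
    by (rule integral_abs_bound)
  also have "\<dots> \<le> measure_pmf.expectation K (\<lambda>z. L * \<Delta> z)"
    by (rule integral_mono[OF integrable_abs[OF iD] integrable_mult_right[OF i\<Delta>]])
       (simp add: \<Delta>_def lip)
  also have "\<dots> \<le> L * B" using E\<Delta> L by (simp add: mult_left_mono)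
  finally show ?thesis by (simp add: B_def)
qed

end

section \<open>Rescaling and conclusion\<close>

lemma integral_normal_law:
  assumes [measurable]: "u \<in> borel_measurable borel" and v: "0 < v"
  shows "(\<integral>x. u x \<partial>normal_law 0 v) = std_normal_expectation (\<lambda>x. u (sqrt v * x))"
proof -
  have "(\<integral>x. u x \<partial>normal_law 0 v) = (\<integral>x. normal_density 0 (sqrt v) x * u x \<partial>lborel)"
    unfolding normal_law_def by (subst integral_density) auto
  also have "\<dots> = \<bar>sqrt v\<bar> *\<^sub>R (\<integral>x. normal_density 0 (sqrt v) (0 + sqrt v * x) * u (0 + sqrt v * x) \<partial>lborel)"
    using v by (intro lborel_integral_real_affine) simp
  also have "\<dots> = (\<integral>x. sqrt v * (normal_density 0 (sqrt v) (sqrt v * x) * u (sqrt v * x)) \<partial>lborel)"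
    using v by simp
  also have "\<dots> = std_normal_expectation (\<lambda>x. u (sqrt v * x))"
  proof (rule Bochner_Integration.integral_cong[OF refl])
    fix x
    have "sqrt v * normal_density 0 (sqrt v) (sqrt v * x) = std_normal_density x"
      using v by (simp add: normal_density_def real_sqrt_mult power_mult_distrib)
    then show "sqrt v * (normal_density 0 (sqrt v) (sqrt v * x) * u (sqrt v * x))
        = std_normal_density x * u (sqrt v * x)"
      by (simp only: mult.assoc[symmetric])
  qed
  finally show ?thesis .
qed

theorem theorem6p7:
  fixes M :: "'a measure" and \<alpha> :: "nat \<Rightarrow> real" and X :: "nat \<Rightarrow> 'a \<Rightarrow> nat"
    and \<alpha>_norm varsigma_sq :: real
  assumes "\<And>k. \<alpha> k > 0"
    and "summable \<alpha>" and "(\<Sum>k. \<alpha> k) < 1"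
    and "summable (\<lambda>k. real k * \<alpha> k)"
    and "discrete_hawkes M \<alpha> X"
    and "\<alpha>_norm = (\<Sum>k. \<alpha> (Suc k))"
    and "varsigma_sq = \<alpha> 0 / (1 - \<alpha>_norm)"
  shows "\<exists>C>0. \<forall>n\<ge>1.
      wasserstein_dist
        (distr M borel (\<lambda>\<omega>. (real (hawkes_count X n \<omega>) - real n * varsigma_sq) / sqrt (real n)))
        (normal_law 0 (varsigma_sq / (1 - \<alpha>_norm)\<^sup>2))
      \<le> ennreal (C / sqrt (real n))"
proof -
  interpret discrete_hawkes M \<alpha> X by fact
  have less_1: "\<alpha>_norm < 1"
    using suminf_split_head[OF assms(2)] assms(1)[of 0] assms(3,6) by simp
  interpret subcritical_kernel \<alpha> \<alpha>_norm
    by unfold_locales (use assms less_1 in auto)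
  define C1 where "C1 = \<alpha> 0 / (1 - \<alpha>_norm)\<^sup>2 * (\<Sum>k. real k * \<alpha> k)"
  \<comment> \<open>\<open>C1\<close> is the mean gap of the coupling, the other summand the
    constant of the normal approximation; both get divided by \<open>sqrt n\<close>.\<close>
  define C where "C = C1 + 28 / (1 - \<alpha>_norm)\<^sup>2"
  define v where "v = varsigma_sq / (1 - \<alpha>_norm)\<^sup>2"
  have v: "0 < v" unfolding v_def assms(7) using \<alpha>_pos less_1 by simp
  have "0 \<le> C1"
    unfolding C1_def using \<alpha>_pos summable_first_moment
    by (intro mult_nonneg_nonneg suminf_nonneg divide_nonneg_nonneg) (auto intro: less_imp_le)
  then have C: "0 < C" using less_1 by (simp add: C_def add_nonneg_pos)
  have "wasserstein_dist
        (distr M borel (\<lambda>\<omega>. (real (hawkes_count X n \<omega>) - real n * varsigma_sq) / sqrt (real n)))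
        (normal_law 0 v) \<le> ennreal (C / sqrt (real n))" if n: "n \<ge> 1" for n
    unfolding wasserstein_dist_def
  proof (rule SUP_least, rule ennreal_leI)
    fix u :: "real \<Rightarrow> real" assume "u \<in> {u. 1-lipschitz_on UNIV u}"
    then have lipu: "1-lipschitz_on UNIV u" by simp
    then have u: "\<bar>u x - u y\<bar> \<le> \<bar>x - y\<bar>" for x y
      using lipschitz_onD[of 1 UNIV u x y] by (simp add: dist_real_def)
    have meas [measurable]: "u \<in> borel_measurable borel"
      by (intro borel_measurable_continuous_onI lipschitz_on_continuous_on[OF lipu])
    have n0: "0 < sqrt (real n)" using n by simp
    \<comment> \<open>This is exactly the mean of the generalized Poisson variable with parameter
      \<open>n * \<alpha> 0\<close>, so the centring causes no further error.\<close>
    define m where "m = real n * varsigma_sq"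
    define \<sigma> where "\<sigma> = sqrt (real n * \<alpha> 0 / (1 - \<alpha>_norm) ^ 3)"
    have \<sigma>: "\<sigma> = sqrt (real n) * sqrt v"
      unfolding \<sigma>_def v_def assms(7) real_sqrt_mult[symmetric]
      by (simp add: power2_eq_square power3_eq_cube mult_ac)
    have \<sigma>0: "0 < \<sigma>" unfolding \<sigma> using n0 v by simp
    define \<phi> where "\<phi> k = u ((real k - m) / sqrt (real n))" for k
    \<comment> \<open>As \<open>\<sigma> = sqrt n * sqrt v\<close>, the test function is dilated by
      \<open>sqrt v\<close> to face a standard normal. Dividing by \<open>sqrt v\<close> restores
      Lipschitz constant 1, and that factor cancels the \<open>sqrt v\<close> contained in
      \<open>\<sigma>\<close> at the end.\<close>
    define w where "w x = u (sqrt v * x) / sqrt v" for x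
    have w: "\<bar>w x - w y\<bar> \<le> \<bar>x - y\<bar>" for x y
    proof -
      have "\<bar>sqrt v * x - sqrt v * y\<bar> = sqrt v * \<bar>x - y\<bar>"
        using v by (simp add: right_diff_distrib[symmetric] abs_mult)
      then have "\<bar>u (sqrt v * x) - u (sqrt v * y)\<bar> \<le> \<bar>x - y\<bar> * sqrt v"
        using u[of "sqrt v * x" "sqrt v * y"] by (simp add: mult.commute)
      then show ?thesis
        using v by (simp add: w_def diff_divide_distrib[symmetric] divide_le_eq)
    qed
    have "\<bar>measure_pmf.expectation (hawkes_pmf \<alpha> n) (\<lambda>xs. \<phi> (sum_list xs))
        - measure_pmf.expectation (gen_poisson_pmf \<alpha>_norm (real n * \<alpha> 0)) \<phi>\<bar> \<le> 1 / sqrt (real n) * C1"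
      unfolding C1_def
    proof (rule hawkes_count_coupling)
      show "\<bar>\<phi> j - \<phi> k\<bar> \<le> 1 / sqrt (real n) * \<bar>real j - real k\<bar>" for j k
        using u[of "(real j - m) / sqrt (real n)" "(real k - m) / sqrt (real n)"] n0
        by (simp add: \<phi>_def diff_divide_distrib[symmetric])
    qed
    moreover have "\<bar>measure_pmf.expectation (gen_poisson_pmf \<alpha>_norm (real n * \<alpha> 0)) \<phi>
        - std_normal_expectation (\<lambda>x. u (sqrt v * x))\<bar> \<le> 28 / (1 - \<alpha>_norm)\<^sup>2 / sqrt (real n)"
    proof -
      have "\<bar>measure_pmf.expectation (gen_poisson_pmf \<alpha>_norm (real n * \<alpha> 0)) (\<lambda>k. w ((real k - m) / \<sigma>))
          - std_normal_expectation w\<bar> \<le> 28 / ((1 - \<alpha>_norm)\<^sup>2 * \<sigma>)"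
        by (rule gen_poisson_clt)
           (use \<mu>_nonneg less_1 n \<alpha>_pos w in \<open>auto simp: m_def assms(7) \<sigma>_def\<close>)
      moreover have "w ((real k - m) / \<sigma>) = \<phi> k / sqrt v" for k
        using v by (simp add: w_def \<phi>_def \<sigma>)
      moreover have "std_normal_expectation w = std_normal_expectation (\<lambda>x. u (sqrt v * x)) / sqrt v"
        by (simp add: w_def[abs_def])
      ultimately have "\<bar>measure_pmf.expectation (gen_poisson_pmf \<alpha>_norm (real n * \<alpha> 0)) \<phi>
          - std_normal_expectation (\<lambda>x. u (sqrt v * x))\<bar> / sqrt v \<le> 28 / ((1 - \<alpha>_norm)\<^sup>2 * \<sigma>)"
        using v by (simp add: diff_divide_distrib[symmetric])
      then show ?thesis
        using v n0 less_1 by (simp add: \<sigma> field_simps)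
    qed
    ultimately have "\<bar>measure_pmf.expectation (hawkes_pmf \<alpha> n) (\<lambda>xs. \<phi> (sum_list xs))
        - std_normal_expectation (\<lambda>x. u (sqrt v * x))\<bar> \<le> C / sqrt (real n)"
      by (simp add: C_def add_divide_distrib)
    then show "\<bar>(\<integral>x. u x \<partial>distr M borel (\<lambda>\<omega>. (real (hawkes_count X n \<omega>) - real n * varsigma_sq) / sqrt (real n)))
        - (\<integral>x. u x \<partial>normal_law 0 v)\<bar> \<le> C / sqrt (real n)"
      unfolding integral_hawkes_count[OF meas] integral_normal_law[OF meas v]
      by (simp add: \<phi>_def m_def)
  qed
  with C show ?thesis unfolding v_def by blast
qed

end
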